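(* Let $-1<\alpha,a,b<+\infty$, $-1<\beta\leq 0$ and $1\leq p<+\infty$. Then the Berezin transform $\mathbb B_{\alpha,\beta}:L^p(\mathbb D,\mu_{a,b})\longrightarrow L^p(\mathbb D,\mu_{a,b})$ is bounded if and only if $$p(\alpha+1)>a+1\quad\text{and}\quad \begin{cases} b\leq \beta & \text{if } p=1,\\ b<p(\beta+1)-1 & \text{if } p>1.\end{cases}$$
   Context: $\mathbb D$ is the open unit disk of $\mathbb C$ and $dA(z)=\frac1\pi\,dx\,dy$. For $a,b>-1$, $\mu_{a,b}$ is the probability measure on $\mathbb D$ given by $$d\mu_{a,b}(z)=\frac{|z|^{2b}(1-|z|^2)^{a}}{\mathscr B(a+1,b+1)}\,dA(z),$$ where $\mathscr B(x,y)=\Gamma(x)\Gamma(y)/\Gamma(x+y)$ is the beta function. (The first index is the exponent of $1-|z|^2$, the second is the exponent of $|z|^2$.) For $\alpha>-1$ and $-1<\beta\le 0$ let $$\mathcal K_{\alpha,\beta}(\xi)={}_2F_1(1,\alpha+\beta+2;\beta+1;\xi)=\sum_{n=0}^{\infty}\frac{(\alpha+\beta+2)_n}{(\beta+1)_n}\xi^n,\qquad \xi\in\mathbb D,$$ with $(x)_n=x(x+1)\cdots(x+n-1)$. The function $\mathbb K_{\alpha,\beta}(z,w)=\mathcal K_{\alpha,\beta}(z\overline w)$ is the reproducing kernel of the modified Bergman space $\mathcal A^2(\mathbb D,\mu_{\alpha,\beta})$ of holomorphic functions on $\mathbb D\setminus\{0\}$ that are square-integrable with respect to $\mu_{\alpha,\beta}$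 (for $\beta\in(-1,0]$ these extend holomorphically to $\mathbb D$), and $\|\mathbb K_{\alpha,\beta}(\cdot,z)\|^2_{L^2(\mathbb D,\mu_{\alpha,\beta})}=\mathcal K_{\alpha,\beta}(|z|^2)$. The Berezin transform of a measurable function $f$ on $\mathbb D$ is $$\mathbb B_{\alpha,\beta}f(z)=\int_{\mathbb D}f(w)\frac{|\mathcal K_{\alpha,\beta}(w\overline z)|^2}{\mathcal K_{\alpha,\beta}(|z|^2)}\,d\mu_{\alpha,\beta}(w),\qquad z\in\mathbb D.$$ "Bounded" means that $\mathbb B_{\alpha,\beta}$ is a well-defined bounded linear operator from $L^p(\mathbb D,\mu_{a,b})$ to itself. *)

theory Defs
  imports "HOL-Analysis.Analysis"
begin

definition disk_area :: "complex measure" where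
  "disk_area = density (restrict_space lborel (ball 0 1)) (\<lambda>_. ennreal (1 / pi))"

definition mu :: "real \<Rightarrow> real \<Rightarrow> complex measure" where
  "mu a b = density disk_area
     (\<lambda>z. ennreal (norm z powr (2 * b) * (1 - (norm z)\<^sup>2) powr a / Beta (a + 1) (b + 1)))"

definition kernel_fun :: "real \<Rightarrow> real \<Rightarrow> complex \<Rightarrow> complex" where
  "kernel_fun \<alpha> \<beta> \<xi> =
     (\<Sum>n. of_real (pochhammer (\<alpha> + \<beta> + 2) n / pochhammer (\<beta> + 1) n) * \<xi> ^ n)"

definition berezin_integrand ::
    "real \<Rightarrow> real \<Rightarrow> (complex \<Rightarrow> complex) \<Rightarrow> complex \<Rightarrow> complex \<Rightarrow> complex" where
  "berezin_integrand \<alpha> \<beta> f z w =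
     f w * (of_real ((norm (kernel_fun \<alpha> \<beta> (w * cnj z)))\<^sup>2)
            / kernel_fun \<alpha> \<beta> (of_real ((norm z)\<^sup>2)))"

definition berezin :: "real \<Rightarrow> real \<Rightarrow> (complex \<Rightarrow> complex) \<Rightarrow> complex \<Rightarrow> complex" where
  "berezin \<alpha> \<beta> f z = integral\<^sup>L (mu \<alpha> \<beta>) (berezin_integrand \<alpha> \<beta> f z)"

text \<open>
  Elements of \<open>Lp_space\<close> are functions rather than classes modulo almost-everywhere
  equality; \<open>bounded_linear_on_Lp\<close> therefore requires compatibility with that equality
  and linearity up to null sets.
\<close>

definition Lp_space :: "'a measure \<Rightarrow> real \<Rightarrow> ('a \<Rightarrow> complex) set" where
  "Lp_space M p = {f \<in> borel_measurable M. integrable M (\<lambda>x. norm (f x) powr p)}"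

definition Lp_norm :: "'a measure \<Rightarrow> real \<Rightarrow> ('a \<Rightarrow> complex) \<Rightarrow> real" where
  "Lp_norm M p f = (\<integral>x. norm (f x) powr p \<partial>M) powr (1 / p)"

definition bounded_linear_on_Lp ::
    "'a measure \<Rightarrow> real \<Rightarrow> (('a \<Rightarrow> complex) \<Rightarrow> ('a \<Rightarrow> complex)) \<Rightarrow> bool" where
  "bounded_linear_on_Lp M p T \<longleftrightarrow>
     (\<forall>f\<in>Lp_space M p. T f \<in> Lp_space M p) \<and>
     (\<forall>f\<in>Lp_space M p. \<forall>g\<in>Lp_space M p.
        (AE x in M. f x = g x) \<longrightarrow> (AE x in M. T f x = T g x)) \<and>
     (\<forall>f\<in>Lp_space M p. \<forall>g\<in>Lp_space M p.
        AE x in M. T (\<lambda>y. f y + g y) x = T f x + T g x) \<and>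
     (\<forall>c. \<forall>f\<in>Lp_space M p. AE x in M. T (\<lambda>y. c * f y) x = c * T f x) \<and>
     (\<exists>C. \<forall>f\<in>Lp_space M p. Lp_norm M p (T f) \<le> C * Lp_norm M p f)"

text \<open>
  The Bochner integral of a non-integrable function is 0 by convention, so convergence of
  the integrals defining the transform is demanded separately.
\<close>

definition berezin_bounded :: "real \<Rightarrow> real \<Rightarrow> real \<Rightarrow> real \<Rightarrow> real \<Rightarrow> bool" where
  "berezin_bounded \<alpha> \<beta> a b p \<longleftrightarrow>
     (\<forall>f\<in>Lp_space (mu a b) p. \<forall>z\<in>ball 0 1.
        integrable (mu \<alpha> \<beta>) (berezin_integrand \<alpha> \<beta> f z)) \<and>
     bounded_linear_on_Lp (mu a b) p (berezin \<alpha> \<beta>)"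

end

(*
  The angular variable is integrated out by orthogonality of the monomials under rotations, so
  only weights that are radial, w |-> |w|^(2(v-1)) (1-|w|^2)^(u-1), ever have to be integrated
  against the squared modulus of the kernel, and the result is a power series in |z|^2 with
  coefficients c_n^2 B(u, v+n), where c_n are the coefficients of the kernel.  Since c_n grows
  like n^(alpha+1) and B(u, v+n) decays like n^(-u), such series are comparable with powers of
  1-|z|^2; no pointwise estimate of the kernel off the real axis is needed.

  Sufficiency is Schur's test with a radial weight |w|^(-2s) (1-|w|^2)^(-t).
  Necessity: testing on powers |w|^(2(v-1)) or (1-|w|^2)^(u-1) whose integral against
  mu_{alpha,beta} is close to divergence and keeping only the constant term of the series
  compares 1/e with (d + p e)^(-1/p) as e -> 0.  This leaves only p = 1, a = alpha, where the
  whole series is kept and its terms, after normalisation, dominate the harmonic series.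
*)

theory Submission
  imports Defs
begin

subsection \<open>Radial integrals over the disk\<close>


text \<open>In |K|^2 / K(|z|^2) only the numerator is symmetric in z and w. Schur's test therefore
  rests on two different estimates: in the w-integral the denominator stays outside and contributes
  the factor (1-|z|^2)^(\<alpha>+2), in the z-integral it becomes part of the weight. Neither
  integral reproduces a singularity at the origin: |w|^(-2s) is integrated away and leaves a bounded
  factor. The origin thus enters only through s < \<beta>+1 (convergence) and b-\<beta> \<le> s(p-1)
  (comparison of weights). For p = 1 the second condition no longer involves s and reads b \<le>
  \<beta>; for p > 1 eliminating s gives the strict b < p(\<beta>+1)-1. This is the source of the
  case distinction. At the boundary all conditions on t are strict. The converse shows the same
  asymmetry. For p = 1 and equality of exponents both sides blow up like 1/e, so the constant term
  yields no contradiction. At the origin there is none to find. At the boundary the test functions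
  concentrate on the unit circle, where in the limit all terms of the series receive the same
  weight.\<close>

text \<open>Uniqueness of translation-invariant measures: a double integral of an indicator of B in
  x and an indicator of D in y - x, evaluated in both orders, shows that the image measure is a
  constant multiple of Lebesgue measure, and a rotation-invariant D makes the constant 1.\<close>

lemma distr_lborel_mult_unimodular:
  fixes c :: complex
  assumes c: "norm c = 1"
  shows "distr lborel borel ((*) c) = lborel"
proof (rule measure_eqI)
  let ?M = "distr lborel borel ((*) c)"
  have [measurable]: "(*) c \<in> borel \<rightarrow>\<^sub>M borel" by simp
  have c0: "c \<noteq> 0" using c by auto
  \<comment> \<open>The exchange of integrals below rests on this. Centred balls are invariant under
    the rotation, so they keep finite mass.\<close>
  interpret M: sigma_finite_measure ?M
  proof
    let ?A = "\<lambda>n::nat. ball (0::complex) (real n)"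
    have "(*) c -` ball 0 r = ball 0 r" for r
      using c by (auto simp: norm_mult)
    then have "emeasure ?M (?A n) = emeasure lborel (?A n)" for n
      by (simp add: emeasure_distr)
    then show "\<exists>A. countable A \<and> A \<subseteq> sets ?M \<and> \<Union> A = space ?M \<and> (\<forall>a\<in>A. emeasure ?M a \<noteq> \<infinity>)"
      using emeasure_lborel_ball_finite
      by (intro exI[of _ "range ?A"]) (auto simp: less_top reals_Archimedean2)
  qed
  interpret P: pair_sigma_finite ?M "lborel :: complex measure" ..
  have trans_lborel: "(\<integral>\<^sup>+x. f (x + t) \<partial>lborel) = (\<integral>\<^sup>+x. f x \<partial>lborel)"
    if [measurable]: "f \<in> borel_measurable borel" for f and t :: complex
  proof -
    have "(\<integral>\<^sup>+x. f x \<partial>lborel) = (\<integral>\<^sup>+x. f x \<partial>distr lborel borel ((+) t))"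
      by (simp only: lborel_distr_plus)
    then show ?thesis by (simp add: nn_integral_distr add.commute)
  qed
  \<comment> \<open>Translating the image by t amounts to translating by t / c before the
    rotation.\<close>
  have trans_M: "(\<integral>\<^sup>+x. f (x + t) \<partial>?M) = (\<integral>\<^sup>+x. f x \<partial>?M)"
    if [measurable]: "f \<in> borel_measurable borel" for f and t :: complex
    using trans_lborel[of "\<lambda>x. f (c * x)" "t / c"] c0
    by (simp add: nn_integral_distr distrib_left)
  \<comment> \<open>The unit disk has finite positive measure, is symmetric under x -> -x and is
    mapped to itself by the rotation; all three properties are used.\<close>
  define D where "D = ball (0::complex) 1"
  have [measurable]: "D \<in> sets borel" by (simp add: D_def)
  fix B assume "B \<in> sets ?M"
  then have [measurable]: "B \<in> sets borel" by simp
  have "emeasure ?M B * emeasure lborel D = (\<integral>\<^sup>+x. indicator B x * (\<integral>\<^sup>+y. indicator D y \<partial>lborel) \<partial>?M)"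
    by (simp add: nn_integral_multc)
  also have "\<dots> = (\<integral>\<^sup>+x. (\<integral>\<^sup>+y. indicator B x * indicator D (y - x) \<partial>lborel) \<partial>?M)"
  proof (rule nn_integral_cong)
    fix x
    have D: "(indicator D :: complex \<Rightarrow> ennreal) \<in> borel_measurable borel"
      by measurable
    have D': "(\<lambda>y. indicator D (y - x) :: ennreal) \<in> borel_measurable lborel"
      by (rule measurable_compose[OF _ D]) simp
    show "indicator B x * (\<integral>\<^sup>+y. indicator D y \<partial>lborel) =
        (\<integral>\<^sup>+y. indicator B x * indicator D (y - x) \<partial>lborel)"
      unfolding nn_integral_cmult[OF D'] using trans_lborel[OF D, of "- x"] by simp
  qed
  also have "\<dots> = (\<integral>\<^sup>+y. (\<integral>\<^sup>+x. indicator B x * indicator D (y - x) \<partial>?M) \<partial>lborel)"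
    by (rule P.Fubini'[symmetric]) measurable
  also have "\<dots> = (\<integral>\<^sup>+y. (\<integral>\<^sup>+x. indicator B (x + y) * indicator D x \<partial>?M) \<partial>lborel)"
  proof (rule nn_integral_cong)
    fix y
    have "indicator D (- x) = (indicator D x :: ennreal)" for x
      by (auto simp: indicator_def D_def)
    then show "(\<integral>\<^sup>+x. indicator B x * indicator D (y - x) \<partial>?M) =
        (\<integral>\<^sup>+x. indicator B (x + y) * indicator D x \<partial>?M)"
      using trans_M[of "\<lambda>x. indicator B x * indicator D (y - x)" y] by simp
  qed
  also have "\<dots> = (\<integral>\<^sup>+x. (\<integral>\<^sup>+y. indicator B (x + y) * indicator D x \<partial>lborel) \<partial>?M)"
    by (rule P.Fubini') measurable
  also have "\<dots> = (\<integral>\<^sup>+x. indicator D x * (\<integral>\<^sup>+y. indicator B y \<partial>lborel) \<partial>?M)"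
  proof (rule nn_integral_cong)
    fix x
    have B: "(indicator B :: complex \<Rightarrow> ennreal) \<in> borel_measurable borel" by measurable
    have B': "(\<lambda>y. indicator B (x + y) :: ennreal) \<in> borel_measurable lborel"
      by (rule measurable_compose[OF _ B]) simp
    show "(\<integral>\<^sup>+y. indicator B (x + y) * indicator D x \<partial>lborel) =
        indicator D x * (\<integral>\<^sup>+y. indicator B y \<partial>lborel)"
      unfolding nn_integral_multc[OF B'] using trans_lborel[OF B, of x]
      by (simp add: add.commute mult.commute)
  qed
  also have "\<dots> = emeasure ?M D * emeasure lborel B"
    by (simp add: nn_integral_multc)
  also have "emeasure ?M D = emeasure lborel D"
  proof -
    have "(*) c -` D = D" using c by (auto simp: norm_mult D_def)
    then show ?thesis by (simp add: emeasure_distr)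
  qed
  finally have *: "emeasure lborel D * emeasure ?M B = emeasure lborel D * emeasure lborel B"
    unfolding mult.commute[of "emeasure ?M B"] .
  have "emeasure lborel D \<noteq> 0"
    by (simp add: emeasure_ball unit_ball_vol_2 D_def)
  then show "emeasure ?M B = emeasure lborel B"
    using * emeasure_lborel_ball_finite[of "0::complex" 1] unfolding D_def
    by (auto simp: ennreal_mult_cancel_left)
qed simp


section \<open>Normalised area and the radial variable t = |w|^2\<close>

lemma space_disk_area [simp]: "space disk_area = ball 0 1"
  by (simp add: disk_area_def space_restrict_space)

lemma sets_disk_area [measurable_cong, simp]: "sets disk_area = sets (restrict_space borel (ball 0 1))"
  by (simp add: disk_area_def sets_restrict_space)

lemma nn_integral_disk_area:
  assumes [measurable]: "f \<in> borel_measurable borel"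
  shows "(\<integral>\<^sup>+w. f w \<partial>disk_area) = (\<integral>\<^sup>+w. (ennreal (1 / pi) * indicator (ball 0 1) w) * f w \<partial>lborel)"
proof -
  have "(\<integral>\<^sup>+w. f w \<partial>disk_area) = (\<integral>\<^sup>+w. ennreal (1 / pi) * f w \<partial>restrict_space lborel (ball 0 1))"
    unfolding disk_area_def by (rule nn_integral_density) (auto intro: measurable_restrict_space1)
  also have "\<dots> = (\<integral>\<^sup>+w. ennreal (1 / pi) * f w * indicator (ball 0 1) w \<partial>lborel)"
    by (rule nn_integral_restrict_space) auto
  finally show ?thesis by (simp add: mult_ac)
qed

text \<open>The image of normalised area under |w|^2 is Lebesgue measure on [0,1]: the part of the
  disk where |w|^2 > x has normalised area 1 - x, and the tails {x<..} determine a measure on the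
  line. This is what turns radial weights into Beta integrals.\<close>

lemma nn_integral_disk_radial:
  assumes [measurable]: "g \<in> borel_measurable (borel :: real measure)"
  shows "(\<integral>\<^sup>+w. g ((norm w)\<^sup>2) \<partial>disk_area) = (\<integral>\<^sup>+t. indicator {0..1} t * g t \<partial>lborel)"
proof -
  have [measurable]: "(\<lambda>w. (norm w)\<^sup>2) \<in> borel_measurable disk_area"
    by (simp add: measurable_restrict_space1 cong: measurable_cong_sets)
  let ?M = "distr disk_area borel (\<lambda>w. (norm w)\<^sup>2)" and ?N = "density lborel (indicator {0..1::real})"
  have pi: "ennreal (1 / pi) * ennreal pi = 1"
    by (simp add: ennreal_mult[symmetric])
  have emN: "emeasure ?N {x<..} = (if x < 0 then 1 else if x < 1 then ennreal (1 - x) else 0)" for x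
  proof -
    have "emeasure ?N {x<..} = emeasure lborel ({0..1} \<inter> {x<..})"
      by (simp add: emeasure_density nn_integral_set_ennreal[symmetric] indicator_inter_arith[symmetric])
    moreover have "{0..1} \<inter> {x<..} = (if x < 0 then {0..1} else if x < 1 then {x<..1} else {})"
      by auto
    ultimately show ?thesis by simp
  qed
  have emM: "emeasure ?M {x<..} = (if x < 0 then 1 else if x < 1 then ennreal (1 - x) else 0)" for x
  proof -
    have "emeasure ?M {x<..} = (\<integral>\<^sup>+t. indicator {x<..} t \<partial>?M)"
      by simp
    also have "\<dots> = (\<integral>\<^sup>+w. indicator {x<..} ((norm w)\<^sup>2) \<partial>disk_area)"
      by (rule nn_integral_distr) auto
    also have "\<dots> = (\<integral>\<^sup>+w. (ennreal (1 / pi) * indicator (ball 0 1) w) * indicator {x<..} ((norm (w::complex))\<^sup>2) \<partial>lborel)"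
      by (rule nn_integral_disk_area) simp
    also have "\<dots> = (\<integral>\<^sup>+w. ennreal (1 / pi) * indicator (ball 0 1 \<inter> {w::complex. x < (norm w)\<^sup>2}) w \<partial>lborel)"
      by (intro nn_integral_cong) (auto simp: indicator_def)
    also have "\<dots> = ennreal (1 / pi) * emeasure lborel (ball 0 1 \<inter> {w::complex. x < (norm w)\<^sup>2})"
      by (subst nn_integral_cmult_indicator) auto
    also have "\<dots> = (if x < 0 then 1 else if x < 1 then ennreal (1 - x) else 0)"
    proof -
      consider "x < 0" | "0 \<le> x" "x < 1" | "x \<ge> 1" by linarith
      then show ?thesis
      proof cases
        case 1
        then have "ball 0 1 \<inter> {w::complex. x < (norm w)\<^sup>2} = ball 0 1"
          by (auto intro: less_le_trans)
        then show ?thesis using 1 pi by (simp add: emeasure_ball unit_ball_vol_2)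
      next
        case 2
        then have sqrt1: "sqrt x < 1" using real_sqrt_less_iff[of x 1] by simp
        have "x < (norm w)\<^sup>2 \<longleftrightarrow> sqrt x < norm w" for w :: complex
          using 2 real_sqrt_less_iff[of x "(norm w)\<^sup>2"] by simp
        then have "ball 0 1 \<inter> {w::complex. x < (norm w)\<^sup>2} = ball 0 1 - cball 0 (sqrt x)"
          by (simp add: set_eq_iff not_le)
        moreover have "emeasure lborel (ball 0 1 - cball 0 (sqrt x) :: complex set) = ennreal (pi - pi * x)"
        proof -
          have "cball 0 (sqrt x) \<subseteq> ball (0::complex) 1" 
            by (rule cball_subset_ball_iff[THEN iffD2]) (use sqrt1 in simp)
          then show ?thesis using 2 by (subst emeasure_Diff)
            (simp_all add: emeasure_ball emeasure_cball unit_ball_vol_2 ennreal_minus)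
        qed
        ultimately show ?thesis using 2
          by (simp add: ennreal_mult[symmetric] field_simps)
      next
        case 3
        have "(norm w)\<^sup>2 < 1" if "norm w < 1" for w :: complex
          using that by (simp add: abs_square_less_1)
        then have "ball 0 1 \<inter> {w::complex. x < (norm w)\<^sup>2} = {}"
          using 3 by fastforce
        then show ?thesis using 3 by simp
      qed
    qed
    finally show ?thesis .
  qed
  have "?M = ?N"
    by (rule measure_eqI_lessThan) (auto simp: emM emN)
  have "(\<integral>\<^sup>+w. g ((norm w)\<^sup>2) \<partial>disk_area) = (\<integral>\<^sup>+t. g t \<partial>?M)"
    by (simp add: nn_integral_distr)
  also note \<open>?M = ?N\<close>
  finally show ?thesis by (simp add: nn_integral_density)
qed

section \<open>Orthogonality of monomials for rotation-invariant measures\<close>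

text \<open>A rotation by c multiplies the integrand by \<open>c ^ n * cnj c ^ m\<close>. The angle
  pi / (n - m) makes this factor -1, so the integral equals its own negative.\<close>

lemma integral_monomial_rotation_invariant:
  fixes M :: "complex measure"
  assumes sets [measurable_cong]: "sets M = sets borel"
    and rot: "\<And>c. norm c = 1 \<Longrightarrow> distr M borel ((*) c) = M"
    and "n \<noteq> m"
  shows "(\<integral>w. w ^ n * cnj w ^ m \<partial>M) = 0"
proof -
  define c where "c = cis (pi / (real n - real m))"
  have "norm c = 1" by (simp add: c_def)
  have "c ^ n * cnj c ^ m = cis (real n * (pi / (real n - real m)) - real m * (pi / (real n - real m)))"
    unfolding c_def cis_cnj by (simp only: Complex.DeMoivre cis_mult) simp
  also have "real n * (pi / (real n - real m)) - real m * (pi / (real n - real m)) = pi"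
    using \<open>n \<noteq> m\<close> by (simp add: diff_divide_distrib[symmetric] left_diff_distrib[symmetric])
  finally have c: "c ^ n * cnj c ^ m = - 1" by simp
  have "(\<integral>w. w ^ n * cnj w ^ m \<partial>M) = (\<integral>w. w ^ n * cnj w ^ m \<partial>distr M borel ((*) c))"
    using rot[OF \<open>norm c = 1\<close>] by simp
  also have "\<dots> = (\<integral>w. (c * w) ^ n * cnj (c * w) ^ m \<partial>M)"
    by (rule integral_distr)
      (auto simp: measurable_cong_sets[OF sets refl] intro!: borel_measurable_continuous_onI continuous_intros)
  also have "\<dots> = (\<integral>w. (c ^ n * cnj c ^ m) * (w ^ n * cnj w ^ m) \<partial>M)"
    by (simp add: power_mult_distrib mult_ac)
  also have "\<dots> = - (\<integral>w. w ^ n * cnj w ^ m \<partial>M)"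
    unfolding c by simp
  finally show ?thesis by (simp add: eq_neg_iff_add_eq_0 mult_2[symmetric])
qed

text \<open>Parseval for polynomials: expand the square and drop the cross terms. It is phrased with
  nonnegative integrals, the form in which infinite sums and exchanges of integrals are handled
  later.\<close>

lemma nn_integral_polynomial_rotation_invariant:
  fixes M :: "complex measure" and a :: "nat \<Rightarrow> complex"
  assumes sets [measurable_cong]: "sets M = sets borel"
    and rot: "\<And>c. norm c = 1 \<Longrightarrow> distr M borel ((*) c) = M"
    and "finite_measure M" and disk: "AE w in M. norm w < 1"
  shows "(\<integral>\<^sup>+w. ennreal ((norm (\<Sum>n<N. a n * w ^ n))\<^sup>2) \<partial>M) =
    (\<Sum>n<N. ennreal ((norm (a n))\<^sup>2) * (\<integral>\<^sup>+w. ennreal (norm w ^ (2 * n)) \<partial>M))"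
proof -
  interpret finite_measure M by fact
  have [measurable]: "(\<lambda>w. w ^ n * cnj w ^ m) \<in> borel_measurable M" for n m
    unfolding measurable_cong_sets[OF sets refl]
    by (intro borel_measurable_continuous_onI continuous_intros)
  have int: "integrable M (\<lambda>w. w ^ n * cnj w ^ m)" for n m
    using disk by (intro integrable_const_bound[of _ 1])
      (auto simp: norm_mult norm_power intro!: mult_le_one power_le_one elim!: eventually_mono)
  have intr: "integrable M (\<lambda>w. norm w ^ (2 * n))" for n
    using disk by (intro integrable_const_bound[of _ 1])
      (auto simp: norm_mult norm_power intro!: mult_le_one power_le_one elim!: eventually_mono)
  have sq: "complex_of_real ((norm u)\<^sup>2) = u * cnj u" for u
    by (rule complex_norm_square)
  have expand: "complex_of_real ((norm (\<Sum>n<N. a n * w ^ n))\<^sup>2) =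
      (\<Sum>n<N. \<Sum>m<N. (a n * cnj (a m)) * (w ^ n * cnj w ^ m))" for w
    unfolding sq cnj_sum sum_product by (simp add: mult_ac)
  have intS: "integrable M (\<lambda>w. complex_of_real ((norm (\<Sum>n<N. a n * w ^ n))\<^sup>2))"
    unfolding expand by (intro Bochner_Integration.integrable_sum integrable_mult_right int)
  then have intS': "integrable M (\<lambda>w. (norm (\<Sum>n<N. a n * w ^ n))\<^sup>2)"
    by (simp only: complex_of_real_integrable_eq)
  have diag: "(\<integral>w. w ^ n * cnj w ^ n \<partial>M) = complex_of_real (\<integral>w. norm w ^ (2 * n) \<partial>M)" for n
  proof -
    have "w ^ n * cnj w ^ n = complex_of_real (norm w ^ (2 * n))" for w
      using sq[of w] by (simp add: power_mult flip: power_mult_distrib)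
    then show ?thesis by (simp only: integral_complex_of_real)
  qed
  \<comment> \<open>The cross terms are complex, so the computation passes through the complex
    Bochner integral and returns to the reals at the end.\<close>
  have "complex_of_real (\<integral>w. (norm (\<Sum>n<N. a n * w ^ n))\<^sup>2 \<partial>M) =
      (\<integral>w. complex_of_real ((norm (\<Sum>n<N. a n * w ^ n))\<^sup>2) \<partial>M)"
    by (rule integral_complex_of_real[symmetric])
  also have "\<dots> = (\<Sum>n<N. \<Sum>m<N. (a n * cnj (a m)) * (\<integral>w. w ^ n * cnj w ^ m \<partial>M))"
    unfolding expand by (simp add: int)
  also have "\<dots> = (\<Sum>n<N. \<Sum>m<N. if m = n then (a n * cnj (a n)) * (\<integral>w. w ^ n * cnj w ^ n \<partial>M) else 0)"
    by (intro sum.cong refl) (auto simp: integral_monomial_rotation_invariant[OF sets rot])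
  also have "\<dots> = complex_of_real (\<Sum>n<N. (norm (a n))\<^sup>2 * (\<integral>w. norm w ^ (2 * n) \<partial>M))"
    by (simp add: diag sq[symmetric])
  finally have eq: "(\<integral>w. (norm (\<Sum>n<N. a n * w ^ n))\<^sup>2 \<partial>M) =
      (\<Sum>n<N. (norm (a n))\<^sup>2 * (\<integral>w. norm w ^ (2 * n) \<partial>M))"
    by (simp only: of_real_eq_iff)
  have "(\<integral>\<^sup>+w. ennreal ((norm (\<Sum>n<N. a n * w ^ n))\<^sup>2) \<partial>M) = ennreal (\<integral>w. (norm (\<Sum>n<N. a n * w ^ n))\<^sup>2 \<partial>M)"
    by (rule nn_integral_eq_integral[OF intS']) simp
  also have "\<dots> = (\<Sum>n<N. ennreal ((norm (a n))\<^sup>2 * (\<integral>w. norm w ^ (2 * n) \<partial>M)))"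
    unfolding eq by (rule sum_ennreal[symmetric]) simp
  also have "\<dots> = (\<Sum>n<N. ennreal ((norm (a n))\<^sup>2) * (\<integral>\<^sup>+w. ennreal (norm w ^ (2 * n)) \<partial>M))"
    by (intro sum.cong refl) (simp add: ennreal_mult nn_integral_eq_integral[OF intr])
  finally show ?thesis .
qed

text \<open>Both sides are limits of the polynomial case. On the left the partial sums are dominated
  by the square of the sum of the |a_n|, a constant and hence integrable for a finite
  measure.\<close>

lemma nn_integral_power_series_rotation_invariant:
  fixes M :: "complex measure" and a :: "nat \<Rightarrow> complex"
  assumes sets [measurable_cong]: "sets M = sets borel"
    and rot: "\<And>c. norm c = 1 \<Longrightarrow> distr M borel ((*) c) = M"
    and fin: "finite_measure M" and disk: "AE w in M. norm w < 1"
    and a: "summable (\<lambda>n. norm (a n))"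
  shows "(\<integral>\<^sup>+w. ennreal ((norm (\<Sum>n. a n * w ^ n))\<^sup>2) \<partial>M) =
    (\<Sum>n. ennreal ((norm (a n))\<^sup>2) * (\<integral>\<^sup>+w. ennreal (norm w ^ (2 * n)) \<partial>M))"
proof (rule LIMSEQ_unique)
  interpret finite_measure M by fact
  let ?B = "\<Sum>n. norm (a n)"
  have term_le: "norm (a n * w ^ n) \<le> norm (a n)" if "norm w < 1" for n w
    using that by (auto simp: norm_mult norm_power intro!: mult_left_le power_le_one)
  show "(\<lambda>N. \<integral>\<^sup>+w. ennreal ((norm (\<Sum>n<N. a n * w ^ n))\<^sup>2) \<partial>M) \<longlonglongrightarrow>
      (\<integral>\<^sup>+w. ennreal ((norm (\<Sum>n. a n * w ^ n))\<^sup>2) \<partial>M)"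
  proof (rule nn_integral_dominated_convergence[where w = "\<lambda>_. ennreal (?B\<^sup>2)"])
    show "AE w in M. ennreal ((norm (\<Sum>n<N. a n * w ^ n))\<^sup>2) \<le> ennreal (?B\<^sup>2)" for N
      using disk
    proof eventually_elim
      case (elim w)
      have "norm (\<Sum>n<N. a n * w ^ n) \<le> (\<Sum>n<N. norm (a n))"
        using term_le[OF elim] by (rule sum_norm_le)
      also have "\<dots> \<le> ?B" using a by (intro sum_le_suminf) auto
      finally show ?case by (intro ennreal_leI power_mono) auto
    qed
    show "(\<integral>\<^sup>+w. ennreal (?B\<^sup>2) \<partial>M) < \<infinity>"
      by (simp add: ennreal_mult_eq_top_iff less_top[symmetric] emeasure_eq_measure)
    show "AE w in M. (\<lambda>N. ennreal ((norm (\<Sum>n<N. a n * w ^ n))\<^sup>2)) \<longlonglongrightarrow> ennreal ((norm (\<Sum>n. a n * w ^ n))\<^sup>2)"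
      using disk
    proof eventually_elim
      case (elim w)
      have "summable (\<lambda>n. a n * w ^ n)"
        using a term_le[OF elim] by (rule summable_comparison_test')
      then show ?case
        by (intro tendsto_ennrealI tendsto_power tendsto_norm summable_LIMSEQ)
    qed
  qed measurable
  show "(\<lambda>N. \<integral>\<^sup>+w. ennreal ((norm (\<Sum>n<N. a n * w ^ n))\<^sup>2) \<partial>M) \<longlonglongrightarrow>
      (\<Sum>n. ennreal ((norm (a n))\<^sup>2) * (\<integral>\<^sup>+w. ennreal (norm w ^ (2 * n)) \<partial>M))"
  proof -
    have "(\<integral>\<^sup>+w. ennreal ((norm (\<Sum>n<N. a n * w ^ n))\<^sup>2) \<partial>M) =
        (\<Sum>n<N. ennreal ((norm (a n))\<^sup>2) * (\<integral>\<^sup>+w. ennreal (norm w ^ (2 * n)) \<partial>M))" for N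
      by (rule nn_integral_polynomial_rotation_invariant[OF sets rot fin disk])
    then show ?thesis by (simp only: summable_LIMSEQ[OF summableI])
  qed
qed

lemma nn_integral_disk_power_series:
  fixes a :: "nat \<Rightarrow> complex" and g :: "real \<Rightarrow> ennreal"
  assumes [measurable]: "g \<in> borel_measurable borel"
    and fin: "(\<integral>\<^sup>+t. indicator {0..1} t * g t \<partial>lborel) < \<infinity>"
    and a: "summable (\<lambda>n. norm (a n))"
  shows "(\<integral>\<^sup>+w. ennreal ((norm (\<Sum>n. a n * w ^ n))\<^sup>2) * g ((norm w)\<^sup>2) \<partial>disk_area) =
    (\<Sum>n. ennreal ((norm (a n))\<^sup>2) * (\<integral>\<^sup>+t. indicator {0..1} t * (ennreal (t ^ n) * g t) \<partial>lborel))"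
proof -
  \<comment> \<open>The radial weight is absorbed into a measure on the whole plane rather than on
    the disk, so that rotation invariance can be inherited from Lebesgue measure: disk and weight
    depend on |w| only.\<close>
  define M where "M = density lborel (\<lambda>w. (ennreal (1 / pi) * indicator (ball 0 1) w) * g ((norm (w::complex))\<^sup>2))"
  have [measurable]: "ball (0::complex) 1 \<in> sets borel" by simp
  have sets [measurable_cong]: "sets M = sets borel" by (simp add: M_def)
  have M: "(\<integral>\<^sup>+w. f w \<partial>M) = (\<integral>\<^sup>+w. f w * g ((norm w)\<^sup>2) \<partial>disk_area)"
    if [measurable]: "f \<in> borel_measurable borel" for f
  proof -
    have "(\<integral>\<^sup>+w. f w \<partial>M) =
        (\<integral>\<^sup>+w. ((ennreal (1 / pi) * indicator (ball 0 1) w) * g ((norm w)\<^sup>2)) * f w \<partial>lborel)"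
      unfolding M_def by (rule nn_integral_density) measurable
    also have "\<dots> = (\<integral>\<^sup>+w. (ennreal (1 / pi) * indicator (ball 0 1) w) * (f w * g ((norm w)\<^sup>2)) \<partial>lborel)"
      by (simp add: mult_ac)
    also have "\<dots> = (\<integral>\<^sup>+w. f w * g ((norm w)\<^sup>2) \<partial>disk_area)"
      by (rule nn_integral_disk_area[symmetric]) measurable
    finally show ?thesis .
  qed
  have rot: "distr M borel ((*) c) = M" if "norm c = 1" for c
  proof (rule measure_eqI)
    fix A assume "A \<in> sets (distr M borel ((*) c))"
    then have [measurable]: "A \<in> sets borel" by simp
    have [measurable]: "(*) c \<in> borel \<rightarrow>\<^sub>M borel" by simp
    let ?G = "\<lambda>w::complex. ((ennreal (1 / pi) * indicator (ball 0 1) w) * g ((norm w)\<^sup>2)) * indicator A w"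
    have "emeasure M A = (\<integral>\<^sup>+w. ?G w \<partial>distr lborel borel ((*) c))"
      using that by (simp add: distr_lborel_mult_unimodular M_def emeasure_density)
    also have "\<dots> = (\<integral>\<^sup>+w. ?G (c * w) \<partial>lborel)"
      by (rule nn_integral_distr) auto
    also have "\<dots> = (\<integral>\<^sup>+w. ((ennreal (1 / pi) * indicator (ball 0 1) w) * g ((norm w)\<^sup>2)) *
        indicator ((*) c -` A) w \<partial>lborel)"
      using that by (intro nn_integral_cong) (auto simp: norm_mult indicator_def)
    also have "\<dots> = emeasure M ((*) c -` A)"
      unfolding M_def by (rule emeasure_density[symmetric])
        (use measurable_sets[of "(*) c" borel borel A] in auto)
    finally show "emeasure (distr M borel ((*) c)) A = emeasure M A"
      by (simp add: emeasure_distr sets sets_eq_imp_space_eq[OF sets])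
  qed (simp add: sets)
  have "emeasure M (space M) < \<infinity>"
    using M[of "\<lambda>_. 1"] fin by (simp add: nn_integral_disk_radial)
  then have finM: "finite_measure M" by (intro finite_measureI) auto
  have disk: "AE w in M. norm w < 1"
    unfolding M_def by (subst AE_density) (auto simp: indicator_def)
  have "(\<integral>\<^sup>+w. ennreal ((norm (\<Sum>n. a n * w ^ n))\<^sup>2) * g ((norm w)\<^sup>2) \<partial>disk_area) =
      (\<integral>\<^sup>+w. ennreal ((norm (\<Sum>n. a n * w ^ n))\<^sup>2) \<partial>M)"
    by (rule M[symmetric]) measurable
  also have "\<dots> = (\<Sum>n. ennreal ((norm (a n))\<^sup>2) * (\<integral>\<^sup>+w. ennreal (norm w ^ (2 * n)) \<partial>M))"
    by (rule nn_integral_power_series_rotation_invariant[OF sets rot finM disk a])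
  finally have "(\<integral>\<^sup>+w. ennreal ((norm (\<Sum>n. a n * w ^ n))\<^sup>2) * g ((norm w)\<^sup>2) \<partial>disk_area) =
      (\<Sum>n. ennreal ((norm (a n))\<^sup>2) * (\<integral>\<^sup>+w. ennreal (norm w ^ (2 * n)) \<partial>M))" .
  moreover have "(\<integral>\<^sup>+w. ennreal (norm w ^ (2 * n)) \<partial>M) =
      (\<integral>\<^sup>+t. indicator {0..1} t * (ennreal (t ^ n) * g t) \<partial>lborel)" for n
    by (subst M) (simp_all add: power_mult nn_integral_disk_radial[of "\<lambda>t. ennreal (t ^ n) * g t", symmetric])
  ultimately show ?thesis by simp
qed

subsection \<open>Sequences of power growth\<close>


text \<open>The bounds hold for every n, with n + 1 in place of n so that n = 0 is covered.
  Comparisons of series are then termwise, without separate treatment of initial terms, and all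
  values are positive.\<close>

definition power_growth :: "(nat \<Rightarrow> real) \<Rightarrow> real \<Rightarrow> bool" where
  "power_growth f e \<longleftrightarrow> (\<exists>c>0. \<exists>C>0. \<forall>n. c * (real n + 1) powr e \<le> f n \<and> f n \<le> C * (real n + 1) powr e)"

lemma power_growth_lower:
  assumes "power_growth f e"
  obtains c where "c > 0" "\<And>n. c * (real n + 1) powr e \<le> f n"
  using assms that unfolding power_growth_def by auto

lemma power_growth_pos:
  assumes "power_growth f e"
  shows "f n > 0"
proof -
  obtain c where c: "c > 0" "\<And>n. c * (real n + 1) powr e \<le> f n"
    using power_growth_lower[OF assms] by metis
  have "0 < c * (real n + 1) powr e" using c(1) by simp
  with c(2)[of n] show ?thesis by simp
qed

lemma power_growth_cmult:
  assumes "power_growth f e" "k > 0"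
  shows "power_growth (\<lambda>n. k * f n) e"
proof -
  obtain c C where "c > 0" "C > 0" "\<And>n. c * (real n + 1) powr e \<le> f n" "\<And>n. f n \<le> C * (real n + 1) powr e"
    using assms(1) unfolding power_growth_def by blast
  then show ?thesis unfolding power_growth_def using assms(2)
    by (intro exI[of _ "k * c"] exI[of _ "k * C"] conjI) (auto simp: mult.assoc mult_left_mono)
qed

lemma power_growth_mult:
  assumes f: "power_growth f e" and g: "power_growth g e'"
  shows "power_growth (\<lambda>n. f n * g n) (e + e')"
proof -
  obtain c C where f': "c > 0" "C > 0" "\<And>n. c * (real n + 1) powr e \<le> f n" "\<And>n. f n \<le> C * (real n + 1) powr e"
    using f unfolding power_growth_def by blast
  obtain d D where g': "d > 0" "D > 0" "\<And>n. d * (real n + 1) powr e' \<le> g n" "\<And>n. g n \<le> D * (real n + 1) powr e'"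
    using g unfolding power_growth_def by blast
  have "c * d * (real n + 1) powr (e + e') \<le> f n * g n" for n
    using mult_mono[OF f'(3)[of n] g'(3)[of n]] f'(1) g'(1) power_growth_pos[OF f, of n]
    by (simp add: powr_add mult_ac)
  moreover have "f n * g n \<le> C * D * (real n + 1) powr (e + e')" for n
    using mult_mono[OF f'(4)[of n] g'(4)[of n]] f'(2) power_growth_pos[OF g, of n]
    by (simp add: powr_add mult_ac)
  ultimately show ?thesis unfolding power_growth_def using f'(1,2) g'(1,2)
    by (intro exI[of _ "c * d"] exI[of _ "C * D"] conjI) auto
qed

lemma power_growth_inverse:
  assumes f: "power_growth f e"
  shows "power_growth (\<lambda>n. inverse (f n)) (- e)"
proof -
  obtain c C where f': "c > 0" "C > 0" "\<And>n. c * (real n + 1) powr e \<le> f n" "\<And>n. f n \<le> C * (real n + 1) powr e"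
    using f unfolding power_growth_def by blast
  have "inverse C * (real n + 1) powr (- e) \<le> inverse (f n)" for n
    using le_imp_inverse_le[OF f'(4)[of n]] power_growth_pos[OF f, of n] by (simp add: powr_minus)
  moreover have "inverse (f n) \<le> inverse c * (real n + 1) powr (- e)" for n
    using le_imp_inverse_le[OF f'(3)[of n]] f'(1) by (simp add: powr_minus)
  ultimately show ?thesis unfolding power_growth_def using f'(1,2)
    by (intro exI[of _ "inverse C"] exI[of _ "inverse c"] conjI) auto
qed

lemma power_growth_divide:
  assumes f: "power_growth f e" and g: "power_growth g e'"
  shows "power_growth (\<lambda>n. f n / g n) (e - e')"
  using power_growth_mult[OF f power_growth_inverse[OF g]] by (simp add: divide_inverse)

text \<open>The upper bound is boundedness of a convergent sequence; the lower bound is the same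
  fact for the reciprocals, which converge because the limit is positive.\<close>

lemma bounds_of_positive_convergent:
  fixes f :: "nat \<Rightarrow> real"
  assumes lim: "f \<longlonglongrightarrow> L" and "L > 0" and pos: "\<And>n. f n > 0"
  obtains c C where "c > 0" "C > 0" "\<And>n. c \<le> f n" "\<And>n. f n \<le> C"
proof -
  have "Bseq f" using lim convergentI convergent_imp_Bseq by blast
  then obtain C where C: "C > 0" "\<And>n. norm (f n) \<le> C" by (auto simp: Bseq_def)
  have "(\<lambda>n. inverse (f n)) \<longlonglongrightarrow> inverse L" using lim \<open>L > 0\<close> by (intro tendsto_inverse) auto
  then have "Bseq (\<lambda>n. inverse (f n))" using convergentI convergent_imp_Bseq by blast
  then obtain D where D: "D > 0" "\<And>n. norm (inverse (f n)) \<le> D" by (auto simp: Bseq_def)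
  have "inverse D \<le> f n" for n
    using D(2)[of n] D(1) pos[of n] by (simp add: field_simps)
  moreover have "f n \<le> C" for n using C(2)[of n] by simp
  ultimately show ?thesis using that[of "inverse D" C] C D by simp
qed

text \<open>Up to a factor tending to 1, the normalised reciprocal \<open>f\<close> is the sequence
  of Euler's limit formula for Gamma, so it tends to Gamma x > 0 and is bounded away from 0 and
  infinity.\<close>

lemma power_growth_pochhammer:
  fixes x :: real
  assumes "x > 0"
  shows "power_growth (\<lambda>n. pochhammer x n / fact n) (x - 1)"
proof -
  define f where "f n = fact n * (real n + 1) powr (x - 1) / pochhammer x n" for n
  \<comment> \<open>The Euler sequence is taken at index n + 1, whose Pochhammer symbol has one more
    factor x + n; the quotient on the right compensates for it and for the power of n + 1.\<close>
  have eq: "f n = Gamma_series' x (Suc n) * ((x + real n) / (real n + 1))" for n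
  proof -
    have pos: "pochhammer x n > 0" "x + real n > 0" using assms by (auto intro: pochhammer_pos)
    have "(real n + 1) powr x = (real n + 1) powr (x - 1) * (real n + 1)"
      by (simp add: powr_diff)
    moreover have "exp (x * ln (1 + real n)) = (real n + 1) powr x"
      by (simp add: powr_def add.commute)
    ultimately have "Gamma_series' x (Suc n) =
        fact n * ((real n + 1) powr (x - 1) * (real n + 1)) / (pochhammer x n * (x + real n))"
      by (simp add: Gamma_series'_def pochhammer_Suc)
    then show ?thesis using pos by (simp add: f_def)
  qed
  have "(\<lambda>n. Gamma_series' x (Suc n) * ((x + real n) / (real n + 1))) \<longlonglongrightarrow> Gamma x * 1"
  proof (intro tendsto_mult)
    show "(\<lambda>n. Gamma_series' x (Suc n)) \<longlonglongrightarrow> Gamma x"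
      by (rule LIMSEQ_Suc[OF Gamma_series'_LIMSEQ])
    have "(\<lambda>n. 1 + (x - 1) / real (Suc n)) \<longlonglongrightarrow> 1 + 0"
      by (intro tendsto_add tendsto_const LIMSEQ_Suc[OF lim_const_over_n])
    moreover have "1 + (x - 1) / real (Suc n) = (x + real n) / (real n + 1)" for n
      by (simp add: field_simps)
    ultimately show "(\<lambda>n. (x + real n) / (real n + 1)) \<longlonglongrightarrow> 1" by simp
  qed
  then have "f \<longlonglongrightarrow> Gamma x" unfolding eq by simp
  moreover have pos: "f n > 0" for n
    unfolding f_def using assms by (simp add: pochhammer_pos)
  ultimately obtain c C where c: "c > 0" "C > 0" "\<And>n. c \<le> f n" "\<And>n. f n \<le> C"
    using bounds_of_positive_convergent[of f "Gamma x"] assms Gamma_real_pos by metis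
  have eq': "pochhammer x n / fact n = (real n + 1) powr (x - 1) * inverse (f n)" for n
    unfolding f_def using pochhammer_pos[OF assms, of n] by (simp add: field_simps)
  have "inverse C * (real n + 1) powr (x - 1) \<le> (real n + 1) powr (x - 1) * inverse (f n)" for n
    using le_imp_inverse_le[OF c(4)[of n]] pos by (simp add: mult.commute mult_left_mono)
  moreover have "(real n + 1) powr (x - 1) * inverse (f n) \<le> inverse c * (real n + 1) powr (x - 1)" for n
    using le_imp_inverse_le[OF c(3)[of n]] c(1) by (simp add: mult.commute mult_left_mono)
  ultimately show ?thesis unfolding power_growth_def eq' using c(1,2)
    by (intro exI[of _ "inverse C"] exI[of _ "inverse c"] conjI) auto
qed

lemma Beta_pos_real: "u > 0 \<Longrightarrow> v > 0 \<Longrightarrow> Beta u v > (0::real)"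
  by (simp add: Beta_def)

lemma Beta_add_nat:
  fixes u v :: real
  assumes "u > 0" "v > 0"
  shows "Beta u (v + real n) = Beta u v * (pochhammer v n / pochhammer (u + v) n)"
proof -
  have [simp]: "Gamma (u + v) \<noteq> 0" "Gamma v \<noteq> 0" "Gamma (u + v + real n) \<noteq> 0"
    by (rule less_imp_neq[OF Gamma_real_pos, symmetric]; use assms in simp)+
  have "v \<notin> \<int>\<^sub>\<le>\<^sub>0" "u + v \<notin> \<int>\<^sub>\<le>\<^sub>0"
    using assms by (auto elim!: nonpos_Ints_cases)
  then show ?thesis
    by (simp add: pochhammer_Gamma Beta_def add.assoc)
qed

lemma power_growth_pochhammer_quotient:
  fixes x y :: real
  assumes "x > 0" "y > 0"
  shows "power_growth (\<lambda>n. pochhammer x n / pochhammer y n) (x - y)"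
  using power_growth_divide[OF power_growth_pochhammer[OF assms(1)] power_growth_pochhammer[OF assms(2)]]
  by simp

lemma power_growth_Beta:
  fixes u v :: real
  assumes "u > 0" "v > 0"
  shows "power_growth (\<lambda>n. Beta u (v + real n)) (- u)"
  using power_growth_cmult[OF power_growth_pochhammer_quotient[of v "u + v"] Beta_pos_real[OF assms]] assms
  by (simp add: Beta_add_nat)

lemma pochhammer_series:
  fixes x r :: real
  assumes "\<bar>r\<bar> < 1"
  shows "(\<lambda>n. pochhammer x n / fact n * r ^ n) sums (1 - r) powr (- x)"
proof -
  have "(\<lambda>n. ((- x) gchoose n) * (- r) ^ n) sums (1 + (- r)) powr (- x)"
    by (rule gen_binomial_real) (use assms in simp)
  moreover have "((- x) gchoose n) * (- r) ^ n = pochhammer x n / fact n * r ^ n" for n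
  proof -
    have "(- 1) ^ n * (- r) ^ n = r ^ n" by (simp only: power_mult_distrib[symmetric]) simp
    then show ?thesis by (simp add: gbinomial_pochhammer mult_ac)
  qed
  ultimately show ?thesis by simp
qed

text \<open>The comparison sequence \<open>?p\<close> consists of the Taylor coefficients of
  (1-r)^(-(e+1)) and has the same growth e; for e > -1 they are positive. The estimate then follows
  term by term from the binomial series.\<close>

lemma power_growth_series:
  assumes f: "power_growth f e" and "e > - 1"
  obtains c C where "c > 0" "C > 0"
    "\<And>r. 0 \<le> r \<Longrightarrow> r < 1 \<Longrightarrow> summable (\<lambda>n. f n * r ^ n)"
    "\<And>r. 0 \<le> r \<Longrightarrow> r < 1 \<Longrightarrow> c * (1 - r) powr (- (e + 1)) \<le> (\<Sum>n. f n * r ^ n)"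
    "\<And>r. 0 \<le> r \<Longrightarrow> r < 1 \<Longrightarrow> (\<Sum>n. f n * r ^ n) \<le> C * (1 - r) powr (- (e + 1))"
proof -
  let ?p = "\<lambda>n. pochhammer (e + 1) n / fact n"
  have p: "power_growth ?p e" using power_growth_pochhammer[of "e + 1"] \<open>e > - 1\<close> by simp
  have "power_growth (\<lambda>n. f n / ?p n) 0" using power_growth_divide[OF f p] by simp
  then obtain c C where c: "c > 0" "C > 0" "\<And>n. c \<le> f n / ?p n" "\<And>n. f n / ?p n \<le> C"
    unfolding power_growth_def by auto
  have le: "c * ?p n \<le> f n" "f n \<le> C * ?p n" for n
    using c(3,4)[of n] power_growth_pos[OF p, of n] by (simp_all add: field_simps)
  show ?thesis
  proof (rule that[of c C])
    fix r :: real assume r: "0 \<le> r" "r < 1"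
    have s: "(\<lambda>n. ?p n * r ^ n) sums (1 - r) powr (- (e + 1))"
      using pochhammer_series[of r "e + 1"] r by simp
    have leC: "f n * r ^ n \<le> C * (?p n * r ^ n)" and lec: "c * (?p n * r ^ n) \<le> f n * r ^ n" for n
      using mult_right_mono[OF le(2)[of n], of "r ^ n"] mult_right_mono[OF le(1)[of n], of "r ^ n"] r
      by (simp_all add: mult.assoc)
    have "summable (\<lambda>n. C * (?p n * r ^ n))" using s sums_summable summable_mult by blast
    then show sf: "summable (\<lambda>n. f n * r ^ n)"
    proof (rule summable_comparison_test')
      show "norm (f n * r ^ n) \<le> C * (?p n * r ^ n)" for n
        using leC[of n] power_growth_pos[OF f, of n] r by (simp only: real_norm_def abs_mult) simp
    qed
    show "(\<Sum>n. f n * r ^ n) \<le> C * (1 - r) powr (- (e + 1))"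
      by (rule sums_le[OF leC summable_sums[OF sf] sums_mult[OF s]])
    show "c * (1 - r) powr (- (e + 1)) \<le> (\<Sum>n. f n * r ^ n)"
      by (rule sums_le[OF lec sums_mult[OF s] summable_sums[OF sf]])
  qed (use c in auto)
qed

text \<open>The pole is removed by e * Gamma e = Gamma (1 + e). That the limit is the same for all y
  matters at the endpoint, where it is taken for a whole family of arguments y at once.\<close>

lemma tendsto_mult_Beta_at_right_0:
  fixes y :: real
  assumes "y > 0"
  shows "((\<lambda>e. e * Beta e y) \<longlongrightarrow> 1) (at_right 0)"
proof -
  have y: "y \<notin> \<int>\<^sub>\<le>\<^sub>0" "(1::real) \<notin> \<int>\<^sub>\<le>\<^sub>0" "Gamma y \<noteq> 0"
    using assms Gamma_real_pos[OF assms] by (auto elim!: nonpos_Ints_cases simp del: Gamma_real_pos)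
  have "((\<lambda>e. Gamma (1 + e) * Gamma y / Gamma (y + e)) \<longlongrightarrow> Gamma (1 + 0) * Gamma y / Gamma (y + 0)) (at_right 0)"
    using y by (intro tendsto_intros) simp_all
  then have "((\<lambda>e. Gamma (1 + e) * Gamma y / Gamma (y + e)) \<longlongrightarrow> 1) (at_right 0)"
    using y by simp
  moreover have "\<forall>\<^sub>F e in at_right 0. Gamma (1 + e) * Gamma y / Gamma (y + e) = e * Beta e y"
    unfolding eventually_at_filter
  proof (intro always_eventually allI impI)
    fix e :: real assume "e \<noteq> 0" "e \<in> {0<..}"
    then have "e \<notin> \<int>\<^sub>\<le>\<^sub>0" by (auto elim!: nonpos_Ints_cases)
    from Gamma_plus1[OF this] show "Gamma (1 + e) * Gamma y / Gamma (y + e) = e * Beta e y"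
      by (simp add: Beta_def add.commute)
  qed
  ultimately show ?thesis by (rule Lim_transform_eventually)
qed

subsection \<open>The measures and the kernel\<close>


text \<open>The argument order follows \<open>mu\<close>: u governs the boundary t = 1, v the origin
  t = 0. The shift by one makes the integral over [0,1] equal to \<open>Beta u v\<close>, and u = v
  = 1 is the constant weight 1 inside the interval.\<close>

definition beta_weight :: "real \<Rightarrow> real \<Rightarrow> real \<Rightarrow> real" where
  "beta_weight u v t = t powr (v - 1) * (1 - t) powr (u - 1)"

lemma beta_weight_nonneg [simp]: "0 \<le> beta_weight u v t"
  by (simp add: beta_weight_def)

lemma borel_measurable_beta_weight [measurable]: "beta_weight u v \<in> borel_measurable borel"
  unfolding beta_weight_def by measurable

lemma nn_integral_beta_weight:
  assumes "u > 0" "v > 0"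
  shows "(\<integral>\<^sup>+t. indicator {0..1} t * (ennreal (t ^ n) * ennreal (beta_weight u v t)) \<partial>lborel) =
    ennreal (Beta u (v + real n))"
proof -
  \<comment> \<open>At t = 0 both sides vanish, since \<open>0 powr x = 0\<close> for every x,
    including x = 0.\<close>
  have eq: "t ^ n * beta_weight u v t = t powr (v + real n - 1) * (1 - t) powr (u - 1)" if "t \<ge> 0" for t
  proof (cases "t = 0")
    case False
    then have "t ^ n * t powr (v - 1) = t powr (v + real n - 1)"
      using that by (simp add: powr_realpow[symmetric] powr_add[symmetric] algebra_simps)
    then show ?thesis by (simp add: beta_weight_def mult.assoc[symmetric])
  qed (simp add: beta_weight_def)
  have "(\<integral>\<^sup>+t. indicator {0..1} t * (ennreal (t ^ n) * ennreal (beta_weight u v t)) \<partial>lborel) =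
      (\<integral>\<^sup>+t. ennreal (indicator {0..1} t * (t powr (v + real n - 1) * (1 - t) powr (u - 1))) \<partial>lborel)"
    by (intro nn_integral_cong) (auto simp: indicator_def eq ennreal_mult[symmetric])
  also have "\<dots> = ennreal (Beta (v + real n) u)"
    using has_integral_Beta_real[of "v + real n" u] assms
    by (intro nn_integral_has_integral_lebesgue) auto
  finally show ?thesis by (simp add: Beta_commute)
qed

lemma norm_powr_eq: "norm (w::complex) powr (2 * b) = ((norm w)\<^sup>2) powr b"
proof (cases "w = 0")
  case False
  then show ?thesis by (simp add: powr_powr flip: powr_numeral)
qed simp

lemma mu_eq_density:
  "mu a b = density disk_area (\<lambda>w. ennreal (beta_weight (a + 1) (b + 1) ((norm w)\<^sup>2) / Beta (a + 1) (b + 1)))"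
  by (simp add: mu_def beta_weight_def norm_powr_eq)

lemma space_mu [simp]: "space (mu a b) = ball 0 1"
  by (simp add: mu_def)

lemma sets_mu [simp, measurable_cong]: "sets (mu a b) = sets disk_area"
  by (simp add: mu_def)

lemma borel_measurable_disk_areaI:
  "f \<in> borel \<rightarrow>\<^sub>M N \<Longrightarrow> f \<in> disk_area \<rightarrow>\<^sub>M N"
  by (auto simp: measurable_cong_sets[OF sets_disk_area refl] intro: measurable_restrict_space1)

lemma nn_integral_mu:
  assumes "f \<in> borel_measurable disk_area"
  shows "(\<integral>\<^sup>+w. f w \<partial>mu a b) =
    (\<integral>\<^sup>+w. ennreal (beta_weight (a + 1) (b + 1) ((norm w)\<^sup>2) / Beta (a + 1) (b + 1)) * f w \<partial>disk_area)"
  unfolding mu_eq_density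
  by (rule nn_integral_density[OF borel_measurable_disk_areaI assms]) measurable

lemma finite_measure_disk_area: "finite_measure disk_area"
proof
  have "emeasure disk_area (space disk_area) = (\<integral>\<^sup>+w. (\<lambda>_. 1) ((norm w)\<^sup>2) \<partial>disk_area)"
    by simp
  also have "\<dots> < \<infinity>" unfolding nn_integral_disk_radial[OF borel_measurable_const] by simp
  finally show "emeasure disk_area (space disk_area) \<noteq> \<infinity>" by simp
qed

text \<open>The origin is discarded because \<open>powr\<close> assigns every weight the value 0
  there, whatever the exponent; formulas with negative or zero powers of |w| are meaningful only off
  this null set.\<close>

lemma AE_disk_area_nonzero: "AE w in disk_area. w \<noteq> 0 \<and> norm w < 1"
proof -
  have "(\<integral>\<^sup>+w. indicator {0} ((norm w)\<^sup>2) \<partial>disk_area) = (\<integral>\<^sup>+t. indicator {0..1} t * indicator {0::real} t \<partial>lborel)"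
    by (rule nn_integral_disk_radial) simp
  also have "\<dots> = (\<integral>\<^sup>+t. indicator {0::real} t \<partial>lborel)"
    by (intro nn_integral_cong) (auto simp: indicator_def)
  also have "\<dots> = 0" by simp
  finally have "AE w in disk_area. indicator {0} ((norm w)\<^sup>2) = (0::ennreal)"
    by (subst (asm) nn_integral_0_iff_AE) (auto intro!: borel_measurable_disk_areaI)
  moreover have "AE w in disk_area. w \<in> space disk_area" by (rule AE_space)
  ultimately show ?thesis
    by eventually_elim (auto simp: indicator_def split: if_splits)
qed

text \<open>All these measures have the same null sets, since their densities are positive off the
  origin. Almost-everywhere statements can thus be moved between \<open>mu a b\<close>, where f
  lives, and \<open>mu \<alpha> \<beta>\<close>, against which it is integrated.\<close>

lemma AE_mu_iff:
  assumes "a > - 1" "b > - 1"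
  shows "(AE w in mu a b. P w) \<longleftrightarrow> (AE w in disk_area. P w)"
proof -
  have pos: "beta_weight (a + 1) (b + 1) ((norm w)\<^sup>2) / Beta (a + 1) (b + 1) > 0"
    if "w \<noteq> 0 \<and> norm w < 1" for w :: complex
    using that Beta_pos_real[of "a + 1" "b + 1"] assms
    by (auto simp: beta_weight_def abs_square_less_1 less_imp_neq)
  have "(AE w in mu a b. P w) \<longleftrightarrow>
      (AE w in disk_area. 0 < ennreal (beta_weight (a + 1) (b + 1) ((norm w)\<^sup>2) / Beta (a + 1) (b + 1)) \<longrightarrow> P w)"
    unfolding mu_eq_density by (rule AE_density) (auto intro!: borel_measurable_disk_areaI)
  also have "\<dots> \<longleftrightarrow> (AE w in disk_area. P w)"
  proof
    assume "AE w in disk_area. 0 < ennreal (beta_weight (a + 1) (b + 1) ((norm w)\<^sup>2) / Beta (a + 1) (b + 1)) \<longrightarrow> P w"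
    with AE_disk_area_nonzero show "AE w in disk_area. P w"
      by eventually_elim (simp add: pos)
  qed (auto elim: eventually_mono)
  finally show ?thesis .
qed

lemma emeasure_space_mu:
  assumes "a > - 1" "b > - 1"
  shows "emeasure (mu a b) (space (mu a b)) = 1"
proof -
  have B: "Beta (a + 1) (b + 1) > 0" using assms by (intro Beta_pos_real) auto
  have "emeasure (mu a b) (space (mu a b)) = (\<integral>\<^sup>+w. 1 \<partial>mu a b)" by simp
  also have "\<dots> = (\<integral>\<^sup>+w. (\<lambda>t. ennreal (beta_weight (a + 1) (b + 1) t / Beta (a + 1) (b + 1))) ((norm w)\<^sup>2) \<partial>disk_area)"
    by (subst nn_integral_mu) auto
  also have "\<dots> = (\<integral>\<^sup>+t. indicator {0..1} t * ennreal (beta_weight (a + 1) (b + 1) t / Beta (a + 1) (b + 1)) \<partial>lborel)"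
    by (rule nn_integral_disk_radial) measurable
  also have "\<dots> = (\<integral>\<^sup>+t. ennreal (1 / Beta (a + 1) (b + 1)) *
      (indicator {0..1} t * (ennreal (t ^ 0) * ennreal (beta_weight (a + 1) (b + 1) t))) \<partial>lborel)"
    using B by (intro nn_integral_cong) (auto simp: indicator_def ennreal_mult[symmetric])
  also have "\<dots> = ennreal (1 / Beta (a + 1) (b + 1)) * ennreal (Beta (a + 1) (b + 1))"
    using nn_integral_beta_weight[of "a + 1" "b + 1" 0] assms by (subst nn_integral_cmult) auto
  also have "\<dots> = 1" using B by (simp add: ennreal_mult[symmetric])
  finally show ?thesis .
qed

section \<open>The kernel, its diagonal and its radial moments\<close>

locale kernel_parameters =
  fixes \<alpha> \<beta> :: real
  assumes \<alpha>: "- 1 < \<alpha>" and \<beta>: "- 1 < \<beta>"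
begin

definition coef :: "nat \<Rightarrow> real" where
  "coef n = pochhammer (\<alpha> + \<beta> + 2) n / pochhammer (\<beta> + 1) n"

lemma power_growth_coef: "power_growth coef (\<alpha> + 1)"
  using power_growth_pochhammer_quotient[of "\<alpha> + \<beta> + 2" "\<beta> + 1"] \<alpha> \<beta>
  by (simp add: coef_def[abs_def])

lemma coef_pos: "coef n > 0"
  by (rule power_growth_pos[OF power_growth_coef])

lemma coef_nonneg [simp]: "coef n \<ge> 0"
  using coef_pos[of n] by simp

lemma coef_0 [simp]: "coef 0 = 1"
  by (simp add: coef_def)

text \<open>At x = |z|^2 this is the squared norm of the reproducing kernel at z, that is, the
  denominator of the transform, as a real number.\<close>

definition diag :: "real \<Rightarrow> real" where
  "diag x = (\<Sum>n. coef n * x ^ n)"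

lemma summable_coef:
  assumes "0 \<le> x" "x < 1"
  shows "summable (\<lambda>n. coef n * x ^ n)"
proof -
  have "\<alpha> + 1 > - 1" using \<alpha> by simp
  from power_growth_series[OF power_growth_coef this] show ?thesis
    using assms by metis
qed

lemma diag_bounds:
  obtains c C where "c > 0" "C > 0"
    "\<And>x. 0 \<le> x \<Longrightarrow> x < 1 \<Longrightarrow> c * (1 - x) powr (- (\<alpha> + 2)) \<le> diag x"
    "\<And>x. 0 \<le> x \<Longrightarrow> x < 1 \<Longrightarrow> diag x \<le> C * (1 - x) powr (- (\<alpha> + 2))"
proof -
  have "\<alpha> + 1 > - 1" using \<alpha> by simp
  from power_growth_coef this show thesis
  proof (rule power_growth_series)
    fix c C :: real
    assume "c > 0" "C > 0"
      and "\<And>x. 0 \<le> x \<Longrightarrow> x < 1 \<Longrightarrow> c * (1 - x) powr (- (\<alpha> + 1 + 1)) \<le> (\<Sum>n. coef n * x ^ n)"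
      and "\<And>x. 0 \<le> x \<Longrightarrow> x < 1 \<Longrightarrow> (\<Sum>n. coef n * x ^ n) \<le> C * (1 - x) powr (- (\<alpha> + 1 + 1))"
    moreover have "\<alpha> + 1 + 1 = \<alpha> + 2" by simp
    ultimately show thesis by (intro that[of c C]) (simp_all only: diag_def)
  qed
qed

lemma diag_ge_1:
  assumes "0 \<le> x" "x < 1"
  shows "diag x \<ge> 1"
proof -
  have "(\<Sum>n\<in>{0}. coef n * x ^ n) \<le> diag x"
    unfolding diag_def using assms by (intro sum_le_suminf summable_coef) auto
  then show ?thesis by simp
qed

lemma diag_mono:
  assumes "0 \<le> x" "x \<le> y" "y < 1"
  shows "diag x \<le> diag y"
  unfolding diag_def using assms
  by (intro suminf_le summable_coef mult_left_mono power_mono) auto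

lemma borel_measurable_diag [measurable]: "diag \<in> borel_measurable borel"
  unfolding diag_def[abs_def] by measurable

lemma kernel_fun_eq: "kernel_fun \<alpha> \<beta> \<xi> = (\<Sum>n. of_real (coef n) * \<xi> ^ n)"
  by (simp add: kernel_fun_def coef_def)

lemma borel_measurable_kernel_fun [measurable]: "kernel_fun \<alpha> \<beta> \<in> borel_measurable borel"
  unfolding kernel_fun_eq[abs_def] by measurable

lemma kernel_fun_of_real:
  assumes "0 \<le> x" "x < 1"
  shows "kernel_fun \<alpha> \<beta> (of_real x) = of_real (diag x)"
  unfolding kernel_fun_eq diag_def
  using suminf_of_real[OF summable_coef[OF assms], where 'a = complex] by simp

lemma summable_norm_kernel:
  assumes "norm (\<xi>::complex) < 1"
  shows "summable (\<lambda>n. norm (of_real (coef n) * \<xi> ^ n))"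
  using summable_coef[of "norm \<xi>"] assms
  by (simp add: norm_mult norm_power)

lemma norm_kernel_fun_le:
  assumes "norm (\<xi>::complex) \<le> r" "r < 1"
  shows "norm (kernel_fun \<alpha> \<beta> \<xi>) \<le> diag r"
proof -
  have "norm (kernel_fun \<alpha> \<beta> \<xi>) \<le> (\<Sum>n. norm (of_real (coef n) * \<xi> ^ n))"
    unfolding kernel_fun_eq using assms by (intro summable_norm summable_norm_kernel) auto
  also have "\<dots> = diag (norm \<xi>)"
    by (simp add: diag_def norm_mult norm_power)
  also have "\<dots> \<le> diag r" using assms by (intro diag_mono) auto
  finally show ?thesis .
qed

text \<open>The coefficients are real, so conjugating the argument conjugates the value. This lets z
  play the part of the integration variable in the column estimate.\<close>

lemma norm_kernel_fun_cnj: "norm (kernel_fun \<alpha> \<beta> (w * cnj z)) = norm (kernel_fun \<alpha> \<beta> (z * cnj w))"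
  if "norm w < 1" "norm z < 1"
proof -
  have "norm (z * cnj w) < 1" using that using mult_strict_mono'[of "norm z" 1 "norm w" 1] by (simp add: norm_mult)
  then have "(\<lambda>n. of_real (coef n) * (z * cnj w) ^ n) sums kernel_fun \<alpha> \<beta> (z * cnj w)"
    unfolding kernel_fun_eq by (intro summable_sums summable_norm_cancel[OF summable_norm_kernel])
  then have "(\<lambda>n. cnj (of_real (coef n) * (z * cnj w) ^ n)) sums cnj (kernel_fun \<alpha> \<beta> (z * cnj w))"
    by (simp only: sums_cnj)
  then have "kernel_fun \<alpha> \<beta> (w * cnj z) = cnj (kernel_fun \<alpha> \<beta> (z * cnj w))"
    unfolding kernel_fun_eq[of "w * cnj z"] by (simp add: sums_iff mult.commute)
  then show ?thesis by simp
qed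

text \<open>In w the kernel is a power series with coefficients \<open>coef n * cnj z ^ n\<close>,
  absolutely summable because |z| < 1, so Parseval applies. Being an identity, it serves the upper
  bounds of the sufficiency part as well as the lower bounds of the necessity part.\<close>

lemma kernel_moment:
  assumes z: "norm z < 1" and "u > 0" "v > 0"
  shows "(\<integral>\<^sup>+w. ennreal ((norm (kernel_fun \<alpha> \<beta> (w * cnj z)))\<^sup>2) * ennreal (beta_weight u v ((norm w)\<^sup>2)) \<partial>disk_area) =
    (\<Sum>n. ennreal ((coef n)\<^sup>2 * Beta u (v + real n) * ((norm z)\<^sup>2) ^ n))"
proof -
  let ?a = "\<lambda>n. of_real (coef n) * cnj z ^ n"
  have "(\<integral>\<^sup>+t. indicator {0..1} t * (\<lambda>t. ennreal (beta_weight u v t)) t \<partial>lborel) < \<infinity>"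
    using nn_integral_beta_weight[OF assms(2,3), of 0] by simp
  from nn_integral_disk_power_series[of "\<lambda>t. ennreal (beta_weight u v t)" ?a, OF _ this] summable_norm_kernel[of "cnj z"] z
  have "(\<integral>\<^sup>+w. ennreal ((norm (\<Sum>n. ?a n * w ^ n))\<^sup>2) * ennreal (beta_weight u v ((norm w)\<^sup>2)) \<partial>disk_area) =
      (\<Sum>n. ennreal ((norm (?a n))\<^sup>2) * ennreal (Beta u (v + real n)))"
    by (simp add: nn_integral_beta_weight[OF assms(2,3)])
  moreover have "(\<Sum>n. ?a n * w ^ n) = kernel_fun \<alpha> \<beta> (w * cnj z)" for w
    unfolding kernel_fun_eq by (simp add: power_mult_distrib mult_ac)
  moreover have "ennreal ((norm (?a n))\<^sup>2) * ennreal (Beta u (v + real n)) =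
      ennreal ((coef n)\<^sup>2 * Beta u (v + real n) * ((norm z)\<^sup>2) ^ n)" for n
    using Beta_pos_real[of u "v + real n"] assms(2,3) coef_pos[of n]
    by (simp add: ennreal_mult[symmetric] norm_mult norm_power power_mult_distrib mult_ac
        flip: power_mult)
  ultimately show ?thesis by simp
qed

text \<open>The terms grow with exponent 2(\<alpha>+1) - u. The condition u < 2\<alpha>+3 says that
  this exceeds -1, so the sum blows up like a genuine power of 1 - |z|^2 rather than a
  logarithm.\<close>

lemma kernel_moment_le:
  assumes "u > 0" "v > 0" "u < 2 * \<alpha> + 3"
  obtains C where "C > 0" "\<And>z. norm z < 1 \<Longrightarrow>
    (\<integral>\<^sup>+w. ennreal ((norm (kernel_fun \<alpha> \<beta> (w * cnj z)))\<^sup>2) * ennreal (beta_weight u v ((norm w)\<^sup>2)) \<partial>disk_area) \<le>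
    ennreal (C * (1 - (norm z)\<^sup>2) powr (- (2 * \<alpha> + 3 - u)))"
proof -
  let ?f = "\<lambda>n. coef n * coef n * Beta u (v + real n)"
  have g: "power_growth ?f (\<alpha> + 1 + (\<alpha> + 1) + (- u))"
    by (intro power_growth_mult power_growth_coef power_growth_Beta assms)
  have e: "\<alpha> + 1 + (\<alpha> + 1) + (- u) > - 1" using assms by simp
  obtain C where C: "C > 0"
    "\<And>r. 0 \<le> r \<Longrightarrow> r < 1 \<Longrightarrow> summable (\<lambda>n. ?f n * r ^ n)"
    "\<And>r. 0 \<le> r \<Longrightarrow> r < 1 \<Longrightarrow> (\<Sum>n. ?f n * r ^ n) \<le> C * (1 - r) powr (- (\<alpha> + 1 + (\<alpha> + 1) + (- u) + 1))"
    by (rule power_growth_series[OF g e]) blast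
  show ?thesis
  proof (rule that[OF C(1)])
    fix z :: complex assume z: "norm z < 1"
    then have r: "0 \<le> (norm z)\<^sup>2" "(norm z)\<^sup>2 < 1" by (auto simp: abs_square_less_1)
    have pos: "0 \<le> ?f n * ((norm z)\<^sup>2) ^ n" for n
      using power_growth_pos[OF g, of n] by simp
    have "(\<Sum>n. ennreal ((coef n)\<^sup>2 * Beta u (v + real n) * ((norm z)\<^sup>2) ^ n)) =
        ennreal (\<Sum>n. ?f n * ((norm z)\<^sup>2) ^ n)"
      unfolding power2_eq_square[of "coef _"] using pos C(2)[OF r] by (intro suminf_ennreal2)
    also have "\<dots> \<le> ennreal (C * (1 - (norm z)\<^sup>2) powr (- (2 * \<alpha> + 3 - u)))"
      using C(3)[OF r] by (intro ennreal_leI) (simp add: algebra_simps)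
    finally show "(\<integral>\<^sup>+w. ennreal ((norm (kernel_fun \<alpha> \<beta> (w * cnj z)))\<^sup>2) * ennreal (beta_weight u v ((norm w)\<^sup>2)) \<partial>disk_area) \<le>
      ennreal (C * (1 - (norm z)\<^sup>2) powr (- (2 * \<alpha> + 3 - u)))"
      unfolding kernel_moment[OF z assms(1,2)] .
  qed
qed

text \<open>The Berezin kernel relative to \<open>mu \<alpha> \<beta>\<close>. It is real, so that
  positivity arguments apply, and it is not symmetric in z and w.\<close>

definition Q :: "complex \<Rightarrow> complex \<Rightarrow> real" where
  "Q z w = (norm (kernel_fun \<alpha> \<beta> (w * cnj z)))\<^sup>2 / diag ((norm z)\<^sup>2)"

lemma berezin_integrand_eq:
  assumes "norm z < 1"
  shows "berezin_integrand \<alpha> \<beta> f z w = f w * of_real (Q z w)"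
  using assms unfolding berezin_integrand_def Q_def
  by (subst kernel_fun_of_real) (auto simp: abs_square_less_1)

lemma Q_nonneg: "norm z < 1 \<Longrightarrow> 0 \<le> Q z w"
  unfolding Q_def using diag_ge_1[of "(norm z)\<^sup>2"] by (auto simp: abs_square_less_1)

text \<open>For fixed z the argument of the kernel satisfies |w cnj z| \<le> |z| < 1, whence a bound
  uniform in w. Convergence of the transform at every z thereby reduces to integrability of
  f.\<close>

lemma Q_le:
  assumes "norm z < 1" "norm w < 1"
  shows "Q z w \<le> (diag (norm z))\<^sup>2"
proof -
  have "norm (w * cnj z) \<le> norm z"
    using assms by (simp add: norm_mult mult_left_le_one_le)
  then have "(norm (kernel_fun \<alpha> \<beta> (w * cnj z)))\<^sup>2 \<le> (diag (norm z))\<^sup>2"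
    using assms by (intro power_mono norm_kernel_fun_le) auto
  moreover have "diag ((norm z)\<^sup>2) \<ge> 1"
    using assms by (intro diag_ge_1) (auto simp: abs_square_less_1)
  ultimately have "Q z w \<le> (diag (norm z))\<^sup>2 / 1"
    unfolding Q_def by (intro frac_le) auto
  then show ?thesis by simp
qed

lemma Q_0: "Q 0 w = 1"
  by (simp add: Q_def kernel_fun_eq diag_def)

lemma borel_measurable_Q [measurable]: "case_prod Q \<in> borel_measurable (borel \<Otimes>\<^sub>M borel)"
proof -
  have [measurable]: "cnj \<in> borel_measurable borel"
    by (intro borel_measurable_continuous_onI continuous_intros)
  show ?thesis unfolding Q_def by measurable
qed

end

subsection \<open>Sufficiency: Schur's test\<close>


lemma beta_weight_mult: "beta_weight u v x * beta_weight u' v' x = beta_weight (u + u' - 1) (v + v' - 1) x"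
proof -
  have "v + v' - 1 - 1 = (v - 1) + (v' - 1)" "u + u' - 1 - 1 = (u - 1) + (u' - 1)" by simp_all
  then show ?thesis by (simp only: beta_weight_def powr_add) (simp add: mult_ac)
qed

text \<open>Either g \<le> c h, or c h < g and then (c h)^(p-1) \<le> g^(p-1), which gives g \<le>
  g^p (c h)^(1-p). Unlike an argument through the conjugate exponent, this treats p = 1 together
  with p > 1.\<close>

lemma le_weighted_sum_powr:
  fixes g h c p :: real
  assumes "g \<ge> 0" "h > 0" "c > 0" "p \<ge> 1"
  shows "g \<le> c * h + c powr (1 - p) * (g powr p * h powr (1 - p))"
proof (cases "g \<le> c * h")
  case False
  then have g: "g > c * h" "g > 0" using mult_pos_pos[OF assms(3,2)] by linarith+
  have "(c * h) powr (p - 1) \<le> g powr (p - 1)"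
    using g assms by (intro powr_mono2) auto
  then have "g * ((c * h) powr (p - 1) * (c * h) powr (1 - p)) \<le> g * (g powr (p - 1) * (c * h) powr (1 - p))"
    using g by (intro mult_left_mono mult_right_mono) auto
  moreover have "(c * h) powr (p - 1) * (c * h) powr (1 - p) = 1"
    using assms by (simp flip: powr_add)
  moreover have "g * g powr (p - 1) = g powr p"
    using g by (simp add: powr_diff)
  ultimately have "g \<le> c powr (1 - p) * (g powr p * h powr (1 - p))"
  proof -
    assume le: "g * ((c * h) powr (p - 1) * (c * h) powr (1 - p)) \<le> g * (g powr (p - 1) * (c * h) powr (1 - p))"
      and one: "(c * h) powr (p - 1) * (c * h) powr (1 - p) = 1" and gp: "g * g powr (p - 1) = g powr p"
    have "g \<le> g * g powr (p - 1) * (c * h) powr (1 - p)"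
      using le unfolding one by (simp add: mult.assoc)
    then show ?thesis unfolding gp using assms by (simp add: powr_mult mult_ac)
  qed
  then show ?thesis using assms mult_pos_pos[OF assms(3,2)] by linarith
next
  case True
  moreover have "0 \<le> c powr (1 - p) * (g powr p * h powr (1 - p))" by simp
  ultimately show ?thesis by linarith
qed

lemma nn_integral_le_weighted_sum:
  fixes g h q :: "'a \<Rightarrow> real"
  assumes [measurable]: "g \<in> borel_measurable M" "h \<in> borel_measurable M" "q \<in> borel_measurable M"
    and g: "\<And>x. g x \<ge> 0" and hq: "AE x in M. h x > 0 \<and> q x \<ge> 0"
    and "c > 0" "p \<ge> 1"
  shows "(\<integral>\<^sup>+x. ennreal (g x * q x) \<partial>M) \<le> ennreal c * (\<integral>\<^sup>+x. ennreal (h x * q x) \<partial>M) +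
    ennreal (c powr (1 - p)) * (\<integral>\<^sup>+x. ennreal (g x powr p * h x powr (1 - p) * q x) \<partial>M)"
proof -
  have "(\<integral>\<^sup>+x. ennreal (g x * q x) \<partial>M) \<le>
      (\<integral>\<^sup>+x. ennreal c * ennreal (h x * q x) + ennreal (c powr (1 - p)) * ennreal (g x powr p * h x powr (1 - p) * q x) \<partial>M)"
  proof (rule nn_integral_mono_AE)
    show "AE x in M. ennreal (g x * q x) \<le>
        ennreal c * ennreal (h x * q x) + ennreal (c powr (1 - p)) * ennreal (g x powr p * h x powr (1 - p) * q x)"
      using hq
    proof eventually_elim
      case (elim x)
      have "g x * q x \<le> (c * h x + c powr (1 - p) * (g x powr p * h x powr (1 - p))) * q x"
        using elim assms by (intro mult_right_mono le_weighted_sum_powr) auto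
      also have "\<dots> = c * (h x * q x) + c powr (1 - p) * (g x powr p * h x powr (1 - p) * q x)"
        by (simp add: algebra_simps)
      finally have "ennreal (g x * q x) \<le> ennreal \<dots>" by (rule ennreal_leI)
      also have "\<dots> = ennreal c * ennreal (h x * q x) + ennreal (c powr (1 - p)) * ennreal (g x powr p * h x powr (1 - p) * q x)"
        using elim \<open>c > 0\<close> by (simp add: ennreal_plus ennreal_mult[symmetric] less_imp_le)
      finally show ?case .
    qed
  qed
  also have "\<dots> = ennreal c * (\<integral>\<^sup>+x. ennreal (h x * q x) \<partial>M) +
    ennreal (c powr (1 - p)) * (\<integral>\<^sup>+x. ennreal (g x powr p * h x powr (1 - p) * q x) \<partial>M)"
    by (simp add: nn_integral_add nn_integral_cmult)
  finally show ?thesis .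
qed

text \<open>The factor 2 avoids the sharp Young inequality and is harmless for boundedness; the bound
  is the previous lemma with the optimal constant \<open>c\<close>.\<close>

lemma nn_integral_weighted_Holder:
  fixes g h q :: "'a \<Rightarrow> real"
  assumes meas: "g \<in> borel_measurable M" "h \<in> borel_measurable M" "q \<in> borel_measurable M"
    and g: "\<And>x. g x \<ge> 0" and hq: "AE x in M. h x > 0 \<and> q x \<ge> 0"
    and "p \<ge> 1" and "N > 0" and N: "(\<integral>\<^sup>+x. ennreal (h x * q x) \<partial>M) \<le> ennreal N"
    and "G \<ge> 0" and G: "(\<integral>\<^sup>+x. ennreal (g x powr p * h x powr (1 - p) * q x) \<partial>M) = ennreal G"
  shows "(\<integral>\<^sup>+x. ennreal (g x * q x) \<partial>M) \<le> ennreal (2 * N powr (1 - 1 / p) * G powr (1 / p))"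
proof -
  have *: "(\<integral>\<^sup>+x. ennreal (g x * q x) \<partial>M) \<le> ennreal (c * N + c powr (1 - p) * G)" if "c > 0" for c
  proof -
    note nn_integral_le_weighted_sum[OF meas g hq that \<open>p \<ge> 1\<close>]
    also have "ennreal c * (\<integral>\<^sup>+x. ennreal (h x * q x) \<partial>M) +
        ennreal (c powr (1 - p)) * (\<integral>\<^sup>+x. ennreal (g x powr p * h x powr (1 - p) * q x) \<partial>M) \<le>
        ennreal c * ennreal N + ennreal (c powr (1 - p)) * ennreal G"
      unfolding G by (intro add_mono mult_left_mono N) auto
    also have "\<dots> = ennreal (c * N + c powr (1 - p) * G)"
      using that \<open>N > 0\<close> \<open>G \<ge> 0\<close> by (simp add: ennreal_plus ennreal_mult[symmetric])
    finally show ?thesis .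
  qed
  show ?thesis
  proof (cases "G = 0")
    case True
    have "(\<integral>\<^sup>+x. ennreal (g x * q x) \<partial>M) \<le> 0"
    proof (rule ennreal_le_epsilon)
      \<comment> \<open>With G = 0 only c * N remains, and c may be taken arbitrarily small.\<close>
      fix e :: real assume "e > 0"
      then show "(\<integral>\<^sup>+x. ennreal (g x * q x) \<partial>M) \<le> 0 + ennreal e"
        using *[of "e / N"] True \<open>N > 0\<close> by simp
    qed
    then show ?thesis by simp
  next
    case False
    then have "G > 0" using \<open>G \<ge> 0\<close> by simp
    \<comment> \<open>This c balances the two terms, c * N = c^(1-p) * G; their sum is twice the
      common value, which is the origin of the factor 2.\<close>
    define c where "c = (G / N) powr (1 / p)"
    have "c > 0" using \<open>G > 0\<close> \<open>N > 0\<close> by (simp add: c_def)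
    have c: "c = G powr (1 / p) * N powr (- (1 / p))"
      using \<open>G > 0\<close> \<open>N > 0\<close> by (simp add: c_def powr_divide powr_minus_divide)
    have "c * N = G powr (1 / p) * (N powr (- (1 / p)) * N powr 1)"
      using \<open>N > 0\<close> by (simp add: c)
    also have "N powr (- (1 / p)) * N powr 1 = N powr (1 - 1 / p)"
      by (subst powr_add[symmetric]) simp
    finally have 1: "c * N = N powr (1 - 1 / p) * G powr (1 / p)" by simp
    have "c powr p = G / N" using \<open>G > 0\<close> \<open>N > 0\<close> \<open>p \<ge> 1\<close> by (simp add: c_def powr_powr)
    then have 2: "c powr (1 - p) * G = c * N"
      using \<open>c > 0\<close> \<open>G > 0\<close> \<open>N > 0\<close> by (simp add: powr_diff)
    show ?thesis using *[OF \<open>c > 0\<close>] unfolding 2 unfolding 1 by (simp add: mult_ac)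
  qed
qed

lemma borel_measurable_pair_mu:
  assumes "f \<in> borel_measurable (borel \<Otimes>\<^sub>M borel)"
  shows "f \<in> borel_measurable (mu a b \<Otimes>\<^sub>M mu c d)"
proof -
  have "id \<in> mu a b \<rightarrow>\<^sub>M borel" for a b
    unfolding measurable_cong_sets[OF sets_mu refl] by (rule borel_measurable_disk_areaI) simp
  from measurable_compose[OF measurable_Pair[OF measurable_compose[OF measurable_fst this]
      measurable_compose[OF measurable_snd this]] assms]
  show ?thesis by simp
qed

lemma finite_measure_mu:
  assumes "a > - 1" "b > - 1"
  shows "finite_measure (mu a b)"
  using emeasure_space_mu[OF assms] by (intro finite_measureI) simp

lemma borel_measurable_muI:
  "f \<in> borel_measurable borel \<Longrightarrow> f \<in> borel_measurable (mu a b)"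
  unfolding measurable_cong_sets[OF sets_mu refl] by (rule borel_measurable_disk_areaI)

lemma AE_mu_nonzero:
  assumes "a > - 1" "b > - 1"
  shows "AE w in mu a b. w \<noteq> 0 \<and> norm w < 1"
  using AE_disk_area_nonzero unfolding AE_mu_iff[OF assms] .

section \<open>Row and column integrals of the Berezin kernel\<close>

context kernel_parameters
begin

lemma borel_measurable_Q2: "Q z \<in> borel_measurable borel"
  using measurable_compose[OF measurable_Pair1' borel_measurable_Q, of z] by simp

lemma diag_pos: "norm (z::complex) < 1 \<Longrightarrow> diag ((norm z)\<^sup>2) > 0"
  using diag_ge_1[of "(norm z)\<^sup>2"] by (auto simp: abs_square_less_1)

lemma inverse_diag_le:
  obtains D where "D > 0" "\<And>x. 0 \<le> x \<Longrightarrow> x < 1 \<Longrightarrow> 1 / diag x \<le> D * (1 - x) powr (\<alpha> + 2)"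
proof (rule diag_bounds)
  fix c C assume c: "c > 0" "\<And>x. 0 \<le> x \<Longrightarrow> x < 1 \<Longrightarrow> c * (1 - x) powr (- (\<alpha> + 2)) \<le> diag x"
  show thesis
  proof (rule that[of "1 / c"])
    fix x :: real assume x: "0 \<le> x" "x < 1"
    have "1 / diag x \<le> 1 / (c * (1 - x) powr (- (\<alpha> + 2)))"
      using c(1) c(2)[OF x] x diag_ge_1[OF x] by (intro divide_left_mono) (auto intro!: mult_pos_pos)
    also have "\<dots> = 1 / c * (1 - x) powr (\<alpha> + 2)"
      unfolding powr_minus_divide by simp
    finally show "1 / diag x \<le> 1 / c * (1 - x) powr (\<alpha> + 2)" .
  qed (use c in simp)
qed

text \<open>Multiplying the test weight by the density of \<open>mu \<alpha> \<beta>\<close> adds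
  exponents, which turns u, v into \<alpha>+u, \<beta>+v. This is the exact transform of a radial
  weight, common to both directions of the theorem.\<close>

lemma nn_integral_Q_beta_weight:
  assumes z: "norm z < 1" and u: "\<alpha> + u > 0" and v: "\<beta> + v > 0"
  shows "(\<integral>\<^sup>+w. ennreal (beta_weight u v ((norm w)\<^sup>2) * Q z w) \<partial>mu \<alpha> \<beta>) =
    ennreal (1 / diag ((norm z)\<^sup>2) / Beta (\<alpha> + 1) (\<beta> + 1)) *
      (\<Sum>n. ennreal ((coef n)\<^sup>2 * Beta (\<alpha> + u) (\<beta> + v + real n) * ((norm z)\<^sup>2) ^ n))"
proof -
  have B: "Beta (\<alpha> + 1) (\<beta> + 1) > 0" using \<alpha> \<beta> by (intro Beta_pos_real) auto
  let ?k = "1 / diag ((norm z)\<^sup>2) / Beta (\<alpha> + 1) (\<beta> + 1)"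
  let ?K = "\<lambda>w. (norm (kernel_fun \<alpha> \<beta> (w * cnj z)))\<^sup>2"
  have k: "?k \<ge> 0" using B diag_pos[OF z] by simp
  have [measurable]: "Q z \<in> borel_measurable borel" by (rule borel_measurable_Q2)
  have "(\<integral>\<^sup>+w. ennreal (beta_weight u v ((norm w)\<^sup>2) * Q z w) \<partial>mu \<alpha> \<beta>) =
      (\<integral>\<^sup>+w. ennreal (beta_weight (\<alpha> + 1) (\<beta> + 1) ((norm w)\<^sup>2) / Beta (\<alpha> + 1) (\<beta> + 1)) *
        ennreal (beta_weight u v ((norm w)\<^sup>2) * Q z w) \<partial>disk_area)"
    by (intro nn_integral_mu borel_measurable_disk_areaI) measurable
  also have "\<dots> = (\<integral>\<^sup>+w. ennreal ?k * (ennreal (?K w) *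
    ennreal (beta_weight (\<alpha> + u) (\<beta> + v) ((norm w)\<^sup>2))) \<partial>disk_area)"
  proof (rule nn_integral_cong)
    fix w :: complex
    have "beta_weight (\<alpha> + 1) (\<beta> + 1) ((norm w)\<^sup>2) * beta_weight u v ((norm w)\<^sup>2) =
        beta_weight (\<alpha> + u) (\<beta> + v) ((norm w)\<^sup>2)"
      unfolding beta_weight_mult by (simp add: algebra_simps)
    then have "beta_weight (\<alpha> + 1) (\<beta> + 1) ((norm w)\<^sup>2) / Beta (\<alpha> + 1) (\<beta> + 1) *
        (beta_weight u v ((norm w)\<^sup>2) * Q z w) =
        ?k * (?K w * beta_weight (\<alpha> + u) (\<beta> + v) ((norm w)\<^sup>2))"
      unfolding Q_def by (simp add: mult_ac)
    then show "ennreal (beta_weight (\<alpha> + 1) (\<beta> + 1) ((norm w)\<^sup>2) / Beta (\<alpha> + 1) (\<beta> + 1)) *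
        ennreal (beta_weight u v ((norm w)\<^sup>2) * Q z w) =
        ennreal ?k * (ennreal (?K w) * ennreal (beta_weight (\<alpha> + u) (\<beta> + v) ((norm w)\<^sup>2)))"
      using k B Q_nonneg[OF z, of w] by (simp only: ennreal_mult[symmetric] beta_weight_nonneg
          mult_nonneg_nonneg zero_le_power2 divide_nonneg_pos)
  qed
  also have "\<dots> = ennreal ?k * (\<integral>\<^sup>+w. ennreal (?K w) *
    ennreal (beta_weight (\<alpha> + u) (\<beta> + v) ((norm w)\<^sup>2)) \<partial>disk_area)"
  proof (rule nn_integral_cmult)
    have [measurable]: "cnj \<in> borel_measurable borel"
      by (intro borel_measurable_continuous_onI continuous_intros)
    show "(\<lambda>w. ennreal (?K w) * ennreal (beta_weight (\<alpha> + u) (\<beta> + v) ((norm w)\<^sup>2)))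
        \<in> borel_measurable disk_area"
      by (rule borel_measurable_disk_areaI) measurable
  qed
  finally show ?thesis unfolding kernel_moment[OF z u v] .
qed

text \<open>The weight is |w|^(-2s) (1-|w|^2)^(-t). The upper bounds on s and t give convergence,
  the lower bound on t keeps the moment above the logarithmic threshold. The moment has size
  (1-|z|^2)^(-(\<alpha>+2+t)), and the denominator of \<open>Q\<close> removes \<alpha>+2 of the
  exponent. The boundary factor is reproduced, the factor at the origin is not.\<close>

lemma kernel_row_bound:
  assumes "s < \<beta> + 1" "t < \<alpha> + 1" "- (\<alpha> + 2) < t"
  obtains C where "C > 0" "\<And>z. norm z < 1 \<Longrightarrow>
    (\<integral>\<^sup>+w. ennreal (beta_weight (1 - t) (1 - s) ((norm w)\<^sup>2) * Q z w) \<partial>mu \<alpha> \<beta>) \<le>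
    ennreal (C * (1 - (norm z)\<^sup>2) powr (- t))"
proof -
  have B: "Beta (\<alpha> + 1) (\<beta> + 1) > 0" using \<alpha> \<beta> by (intro Beta_pos_real) auto
  have uv: "\<alpha> + (1 - t) > 0" "\<beta> + (1 - s) > 0" using assms by simp_all
  obtain D where D: "D > 0" "\<And>x. 0 \<le> x \<Longrightarrow> x < 1 \<Longrightarrow> 1 / diag x \<le> D * (1 - x) powr (\<alpha> + 2)"
    by (rule inverse_diag_le) blast
  obtain C where C: "C > 0" "\<And>z. norm z < 1 \<Longrightarrow>
      (\<integral>\<^sup>+w. ennreal ((norm (kernel_fun \<alpha> \<beta> (w * cnj z)))\<^sup>2) *
        ennreal (beta_weight (\<alpha> + (1 - t)) (\<beta> + (1 - s)) ((norm w)\<^sup>2)) \<partial>disk_area) \<le>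
      ennreal (C * (1 - (norm z)\<^sup>2) powr (- (2 * \<alpha> + 3 - (\<alpha> + (1 - t)))))"
    by (rule kernel_moment_le[OF uv]) (use assms in auto)
  show ?thesis
  proof (rule that[of "D * C / Beta (\<alpha> + 1) (\<beta> + 1)"])
    fix z :: complex assume z: "norm z < 1"
    then have x: "0 \<le> (norm z)\<^sup>2" "(norm z)\<^sup>2 < 1" by (auto simp: abs_square_less_1)
    have "(\<integral>\<^sup>+w. ennreal (beta_weight (1 - t) (1 - s) ((norm w)\<^sup>2) * Q z w) \<partial>mu \<alpha> \<beta>) \<le>
        ennreal (D * (1 - (norm z)\<^sup>2) powr (\<alpha> + 2) / Beta (\<alpha> + 1) (\<beta> + 1)) *
        ennreal (C * (1 - (norm z)\<^sup>2) powr (- (2 * \<alpha> + 3 - (\<alpha> + (1 - t)))))"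
      unfolding nn_integral_Q_beta_weight[OF z uv] kernel_moment[OF z uv, symmetric]
      using D(2)[OF x] C(2)[OF z] B by (intro mult_mono ennreal_leI divide_right_mono) auto
    also have "\<dots> = ennreal (D * C / Beta (\<alpha> + 1) (\<beta> + 1) *
        ((1 - (norm z)\<^sup>2) powr (\<alpha> + 2) * (1 - (norm z)\<^sup>2) powr (- (2 * \<alpha> + 3 - (\<alpha> + (1 - t))))))"
      using D(1) C(1) B by (simp add: ennreal_mult[symmetric] mult_ac)
    also have "(1 - (norm z)\<^sup>2) powr (\<alpha> + 2) * (1 - (norm z)\<^sup>2) powr (- (2 * \<alpha> + 3 - (\<alpha> + (1 - t)))) =
        (1 - (norm z)\<^sup>2) powr (- t)"
      by (simp flip: powr_add)
    finally show "(\<integral>\<^sup>+w. ennreal (beta_weight (1 - t) (1 - s) ((norm w)\<^sup>2) * Q z w) \<partial>mu \<alpha> \<beta>) \<le>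
        ennreal (D * C / Beta (\<alpha> + 1) (\<beta> + 1) * (1 - (norm z)\<^sup>2) powr (- t))" .
  qed (use D C B in simp)
qed

text \<open>Here 1 / \<open>diag\<close> stands under the integral. Its factor
  (1-|z|^2)^(\<alpha>+2) together with the density and the weight gives the boundary parameter u =
  a+\<alpha>+3-r, and the two bounds on r are exactly 0 < u < 2\<alpha>+3. At the origin only b > -1
  intervenes.\<close>

lemma kernel_column_bound:
  assumes ab: "- 1 < a" "- 1 < b" and r: "a - \<alpha> < r" "r < a + \<alpha> + 3"
  obtains C where "C > 0" "\<And>w. norm w < 1 \<Longrightarrow>
    (\<integral>\<^sup>+z. ennreal ((1 - (norm z)\<^sup>2) powr (- r) * Q z w) \<partial>mu a b) \<le>
    ennreal (C * (1 - (norm w)\<^sup>2) powr (- (\<alpha> - a + r)))"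
proof -
  have B: "Beta (a + 1) (b + 1) > 0" using ab by (intro Beta_pos_real) auto
  obtain D where D: "D > 0" "\<And>x. 0 \<le> x \<Longrightarrow> x < 1 \<Longrightarrow> 1 / diag x \<le> D * (1 - x) powr (\<alpha> + 2)"
    by (rule inverse_diag_le) blast
  let ?u = "a + \<alpha> + 3 - r"
  let ?K = "\<lambda>w. \<integral>\<^sup>+z. ennreal ((norm (kernel_fun \<alpha> \<beta> (z * cnj w)))\<^sup>2) *
      ennreal (beta_weight ?u (b + 1) ((norm z)\<^sup>2)) \<partial>disk_area"
  obtain C where C: "C > 0" "\<And>w. norm w < 1 \<Longrightarrow>
      ?K w \<le> ennreal (C * (1 - (norm w)\<^sup>2) powr (- (2 * \<alpha> + 3 - ?u)))"
    by (rule kernel_moment_le[of ?u "b + 1"]) (use assms in auto)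
  show ?thesis
  proof (rule that[of "D / Beta (a + 1) (b + 1) * C"])
    fix w :: complex assume w: "norm w < 1"
    have [measurable]: "(\<lambda>z. Q z w) \<in> borel_measurable borel"
      using measurable_compose[OF measurable_Pair2' borel_measurable_Q, of w] by simp
    have "(\<integral>\<^sup>+z. ennreal ((1 - (norm z)\<^sup>2) powr (- r) * Q z w) \<partial>mu a b) =
        (\<integral>\<^sup>+z. ennreal (beta_weight (a + 1) (b + 1) ((norm z)\<^sup>2) / Beta (a + 1) (b + 1)) *
          ennreal ((1 - (norm z)\<^sup>2) powr (- r) * Q z w) \<partial>disk_area)"
      by (intro nn_integral_mu borel_measurable_disk_areaI) measurable
    also have "\<dots> \<le> (\<integral>\<^sup>+z. ennreal (D / Beta (a + 1) (b + 1)) *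
        (ennreal ((norm (kernel_fun \<alpha> \<beta> (z * cnj w)))\<^sup>2) * ennreal (beta_weight ?u (b + 1) ((norm z)\<^sup>2))) \<partial>disk_area)"
    proof (rule nn_integral_mono)
      fix z assume "z \<in> space disk_area"
      then have z: "norm z < 1" by simp
      then have x: "0 \<le> (norm z)\<^sup>2" "(norm z)\<^sup>2 < 1" by (auto simp: abs_square_less_1)
      let ?x = "(norm z)\<^sup>2" and ?k = "(norm (kernel_fun \<alpha> \<beta> (z * cnj w)))\<^sup>2"
      have "beta_weight (a + 1) (b + 1) ?x / Beta (a + 1) (b + 1) * ((1 - ?x) powr (- r) * Q z w) =
          beta_weight (a + 1) (b + 1) ?x / Beta (a + 1) (b + 1) * (1 - ?x) powr (- r) * ?k * (1 / diag ?x)"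
        unfolding Q_def using norm_kernel_fun_cnj[OF w z] by simp
      also have "\<dots> \<le> beta_weight (a + 1) (b + 1) ?x / Beta (a + 1) (b + 1) * (1 - ?x) powr (- r) * ?k *
          (D * (1 - ?x) powr (\<alpha> + 2))"
        using D(2)[OF x] B by (intro mult_left_mono) auto
      also have "\<dots> = D / Beta (a + 1) (b + 1) * (?k * (?x powr b *
          ((1 - ?x) powr a * (1 - ?x) powr (- r) * (1 - ?x) powr (\<alpha> + 2))))"
        by (simp add: beta_weight_def mult_ac)
      also have "(1 - ?x) powr a * (1 - ?x) powr (- r) * (1 - ?x) powr (\<alpha> + 2) = (1 - ?x) powr (?u - 1)"
        by (simp only: powr_add[symmetric]) (simp add: algebra_simps)
      finally have "beta_weight (a + 1) (b + 1) ?x / Beta (a + 1) (b + 1) * ((1 - ?x) powr (- r) * Q z w) \<le>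
          D / Beta (a + 1) (b + 1) * (?k * beta_weight ?u (b + 1) ?x)"
        by (simp add: beta_weight_def)
      then have "ennreal (beta_weight (a + 1) (b + 1) ?x / Beta (a + 1) (b + 1) * ((1 - ?x) powr (- r) * Q z w)) \<le>
          ennreal (D / Beta (a + 1) (b + 1) * (?k * beta_weight ?u (b + 1) ?x))"
        by (rule ennreal_leI)
      then show "ennreal (beta_weight (a + 1) (b + 1) ?x / Beta (a + 1) (b + 1)) *
          ennreal ((1 - ?x) powr (- r) * Q z w) \<le>
          ennreal (D / Beta (a + 1) (b + 1)) * (ennreal ?k * ennreal (beta_weight ?u (b + 1) ?x))"
        using B D(1) Q_nonneg[OF z, of w] by (simp add: ennreal_mult[symmetric])
    qed
    also have "\<dots> = ennreal (D / Beta (a + 1) (b + 1)) * ?K w"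
    proof (rule nn_integral_cmult)
      have [measurable]: "cnj \<in> borel_measurable borel"
        by (intro borel_measurable_continuous_onI continuous_intros)
      show "(\<lambda>z. ennreal ((norm (kernel_fun \<alpha> \<beta> (z * cnj w)))\<^sup>2) *
          ennreal (beta_weight ?u (b + 1) ((norm z)\<^sup>2))) \<in> borel_measurable disk_area"
        by (rule borel_measurable_disk_areaI) measurable
    qed
    also have "\<dots> \<le> ennreal (D / Beta (a + 1) (b + 1)) * ennreal (C * (1 - (norm w)\<^sup>2) powr (- (2 * \<alpha> + 3 - ?u)))"
      using C(2)[OF w] by (intro mult_left_mono) auto
    also have "\<dots> = ennreal (D / Beta (a + 1) (b + 1) * C * (1 - (norm w)\<^sup>2) powr (- (\<alpha> - a + r)))"
      using D(1) C(1) B by (simp add: ennreal_mult[symmetric] algebra_simps)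
    finally show "(\<integral>\<^sup>+z. ennreal ((1 - (norm z)\<^sup>2) powr (- r) * Q z w) \<partial>mu a b) \<le>
        ennreal (D / Beta (a + 1) (b + 1) * C * (1 - (norm w)\<^sup>2) powr (- (\<alpha> - a + r)))" .
  qed (use D C B in simp)
qed

end


lemma Lp_space_measurable: "f \<in> Lp_space M p \<Longrightarrow> f \<in> borel_measurable M"
  by (simp add: Lp_space_def)

lemma Lp_space_nn_integral:
  assumes "f \<in> Lp_space M p"
  shows "(\<integral>\<^sup>+x. ennreal (norm (f x) powr p) \<partial>M) = ennreal (\<integral>x. norm (f x) powr p \<partial>M)"
  using assms unfolding Lp_space_def by (intro nn_integral_eq_integral) auto

text \<open>The powers of 1 - x cancel to exactly a. The only inequality is at the origin, where the
  exponent s(p-1)+\<beta> must be at least b for 0 < x < 1.\<close>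

lemma schur_weight_le:
  fixes x :: real
  assumes x: "0 < x" "x < 1" and s: "b - \<beta> \<le> s * (p - 1)"
  shows "beta_weight (1 - t) (1 - s) x powr (1 - p) * (1 - x) powr (- (\<alpha> - a + t * (p - 1))) *
    beta_weight (\<alpha> + 1) (\<beta> + 1) x \<le> beta_weight (a + 1) (b + 1) x"
proof -
  have "beta_weight (1 - t) (1 - s) x powr (1 - p) = x powr (s * (p - 1)) * (1 - x) powr (t * (p - 1))"
    using x by (simp add: beta_weight_def powr_mult powr_powr algebra_simps)
  then have "beta_weight (1 - t) (1 - s) x powr (1 - p) * (1 - x) powr (- (\<alpha> - a + t * (p - 1))) *
      beta_weight (\<alpha> + 1) (\<beta> + 1) x =
      (x powr (s * (p - 1)) * x powr \<beta>) *
      ((1 - x) powr (t * (p - 1)) * (1 - x) powr (- (\<alpha> - a + t * (p - 1))) * (1 - x) powr \<alpha>)"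
    by (simp add: beta_weight_def mult_ac)
  also have "\<dots> = x powr (s * (p - 1) + \<beta>) * (1 - x) powr a"
    by (simp only: powr_add[symmetric]) simp
  also have "\<dots> \<le> x powr b * (1 - x) powr a"
    using x s by (intro mult_right_mono powr_mono') auto
  finally show ?thesis by (simp add: beta_weight_def)
qed

section \<open>Schur's test with admissible exponents\<close>

context kernel_parameters
begin

text \<open>The conditions s < \<beta>+1 and -(\<alpha>+2) < t < \<alpha>+1 are those of the row
  bound, a-\<alpha> < t(p-1) < a+\<alpha>+3 those of the column bound with r = t(p-1), and b-\<beta>
  \<le> s(p-1) that of the comparison of weights.\<close>

context
  fixes a b p s t :: real
  assumes ab: "- 1 < a" "- 1 < b" and p: "1 \<le> p"
    and s: "s < \<beta> + 1" "b - \<beta> \<le> s * (p - 1)"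
    and t: "t < \<alpha> + 1" "- (\<alpha> + 2) < t" "a - \<alpha> < t * (p - 1)" "t * (p - 1) < a + \<alpha> + 3"
begin

lemma schur_weight_integral_le:
  fixes f :: "complex \<Rightarrow> complex"
  assumes f: "f \<in> borel_measurable disk_area"
  shows "(\<integral>\<^sup>+w. ennreal (norm (f w) powr p * beta_weight (1 - t) (1 - s) ((norm w)\<^sup>2) powr (1 - p) *
      (1 - (norm w)\<^sup>2) powr (- (\<alpha> - a + t * (p - 1)))) \<partial>mu \<alpha> \<beta>) \<le>
    ennreal (Beta (a + 1) (b + 1) / Beta (\<alpha> + 1) (\<beta> + 1)) * (\<integral>\<^sup>+w. ennreal (norm (f w) powr p) \<partial>mu a b)"
proof -
  have B: "Beta (\<alpha> + 1) (\<beta> + 1) > 0" "Beta (a + 1) (b + 1) > 0"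
    using \<alpha> \<beta> ab by (auto intro: Beta_pos_real)
  have [measurable]: "f \<in> borel_measurable disk_area" by (rule f)
  have [measurable]: "(\<lambda>w. (norm w)\<^sup>2) \<in> borel_measurable disk_area"
    by (rule borel_measurable_disk_areaI) measurable
  let ?H = "\<lambda>w. beta_weight (1 - t) (1 - s) ((norm w)\<^sup>2) powr (1 - p) *
      (1 - (norm (w::complex))\<^sup>2) powr (- (\<alpha> - a + t * (p - 1)))"
  let ?W = "\<lambda>w. beta_weight (\<alpha> + 1) (\<beta> + 1) ((norm (w::complex))\<^sup>2) / Beta (\<alpha> + 1) (\<beta> + 1)"
  let ?V = "\<lambda>w. beta_weight (a + 1) (b + 1) ((norm (w::complex))\<^sup>2) / Beta (a + 1) (b + 1)"
  let ?c = "Beta (a + 1) (b + 1) / Beta (\<alpha> + 1) (\<beta> + 1)"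
  have "(\<integral>\<^sup>+w. ennreal (norm (f w) powr p * beta_weight (1 - t) (1 - s) ((norm w)\<^sup>2) powr (1 - p) *
      (1 - (norm w)\<^sup>2) powr (- (\<alpha> - a + t * (p - 1)))) \<partial>mu \<alpha> \<beta>) =
      (\<integral>\<^sup>+w. ennreal (?W w) * ennreal (norm (f w) powr p * ?H w) \<partial>disk_area)"
    by (subst nn_integral_mu) (simp_all add: mult.assoc)
  also have "\<dots> \<le> (\<integral>\<^sup>+w. ennreal ?c * (ennreal (?V w) * ennreal (norm (f w) powr p)) \<partial>disk_area)"
  proof (rule nn_integral_mono_AE)
    show "AE w in disk_area. ennreal (?W w) * ennreal (norm (f w) powr p * ?H w) \<le>
        ennreal ?c * (ennreal (?V w) * ennreal (norm (f w) powr p))"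
      using AE_disk_area_nonzero
    proof eventually_elim
      case (elim w)
      then have x: "0 < (norm w)\<^sup>2" "(norm w)\<^sup>2 < 1" by (auto simp: abs_square_less_1)
      have "?W w * (norm (f w) powr p * ?H w) =
          norm (f w) powr p / Beta (\<alpha> + 1) (\<beta> + 1) * (?H w * beta_weight (\<alpha> + 1) (\<beta> + 1) ((norm w)\<^sup>2))"
        by (simp add: mult_ac)
      also have "\<dots> \<le> norm (f w) powr p / Beta (\<alpha> + 1) (\<beta> + 1) * beta_weight (a + 1) (b + 1) ((norm w)\<^sup>2)"
        using B by (intro mult_left_mono schur_weight_le x s) auto
      also have "\<dots> = ?c * (?V w * norm (f w) powr p)"
        using B by simp
      finally have "ennreal (?W w * (norm (f w) powr p * ?H w)) \<le> ennreal (?c * (?V w * norm (f w) powr p))"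
        by (rule ennreal_leI)
      moreover have nn: "0 \<le> ?W w" "0 \<le> norm (f w) powr p * ?H w" "0 \<le> ?c" "0 \<le> ?V w" "0 \<le> norm (f w) powr p"
        using B by simp_all
      ultimately show ?case
        unfolding ennreal_mult[OF nn(1,2), symmetric] ennreal_mult[OF nn(4,5), symmetric]
          ennreal_mult[OF nn(3) mult_nonneg_nonneg[OF nn(4,5)], symmetric] by simp
    qed
  qed
  also have "\<dots> = ennreal ?c * (\<integral>\<^sup>+w. ennreal (?V w) * ennreal (norm (f w) powr p) \<partial>disk_area)"
    by (rule nn_integral_cmult) measurable
  also have "(\<integral>\<^sup>+w. ennreal (?V w) * ennreal (norm (f w) powr p) \<partial>disk_area) = (\<integral>\<^sup>+w. ennreal (norm (f w) powr p) \<partial>mu a b)"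
    by (subst nn_integral_mu) auto
  finally show ?thesis .
qed

text \<open>The weighted inequality with c = 1 and q = 1 bounds |f| by the Schur weight plus |f|^p
  times a power of it; both are integrable for \<open>mu \<alpha> \<beta>\<close>.\<close>

lemma Lp_space_imp_finite_nn_integral:
  assumes "f \<in> Lp_space (mu a b) p"
  shows "(\<integral>\<^sup>+w. ennreal (norm (f w)) \<partial>mu \<alpha> \<beta>) < \<infinity>"
proof -
  have f [measurable]: "f \<in> borel_measurable disk_area"
    using Lp_space_measurable[OF assms] by simp
  let ?H = "\<lambda>w. beta_weight (1 - t) (1 - s) ((norm (w::complex))\<^sup>2)"
  have H: "?H \<in> borel_measurable (mu \<alpha> \<beta>)" by (rule borel_measurable_muI) measurable
  have Hpos: "AE w in mu \<alpha> \<beta>. ?H w > 0 \<and> (1::real) \<ge> 0"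
    using AE_mu_nonzero[OF \<alpha> \<beta>] by eventually_elim (auto simp: beta_weight_def abs_square_less_1 less_imp_neq)
  have "(\<integral>\<^sup>+w. ennreal (norm (f w) * 1) \<partial>mu \<alpha> \<beta>) \<le> ennreal 1 * (\<integral>\<^sup>+w. ennreal (?H w * 1) \<partial>mu \<alpha> \<beta>) +
      ennreal (1 powr (1 - p)) * (\<integral>\<^sup>+w. ennreal (norm (f w) powr p * ?H w powr (1 - p) * 1) \<partial>mu \<alpha> \<beta>)"
    using p by (intro nn_integral_le_weighted_sum H Hpos) auto
  also have "\<dots> < \<infinity>"
  proof -
    obtain C where C: "C > 0" "\<And>z. norm z < 1 \<Longrightarrow>
        (\<integral>\<^sup>+w. ennreal (?H w * Q z w) \<partial>mu \<alpha> \<beta>) \<le> ennreal (C * (1 - (norm z)\<^sup>2) powr (- t))"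
      by (rule kernel_row_bound[OF s(1) t(1,2)]) blast
    \<comment> \<open>At z = 0 the kernel \<open>Q\<close> is identically 1, so the row bound is a
      bound for the plain integral of the weight.\<close>
    have "(\<integral>\<^sup>+w. ennreal (?H w * 1) \<partial>mu \<alpha> \<beta>) \<le> ennreal C"
      using C(2)[of 0] by (simp add: Q_0)
    then have 1: "(\<integral>\<^sup>+w. ennreal (?H w * 1) \<partial>mu \<alpha> \<beta>) < \<infinity>" by (simp add: le_less_trans)
    have "(\<integral>\<^sup>+w. ennreal (norm (f w) powr p * ?H w powr (1 - p) * 1) \<partial>mu \<alpha> \<beta>) \<le>
        (\<integral>\<^sup>+w. ennreal (norm (f w) powr p * ?H w powr (1 - p) *
          (1 - (norm w)\<^sup>2) powr (- (\<alpha> - a + t * (p - 1)))) \<partial>mu \<alpha> \<beta>)"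
    proof (rule nn_integral_mono_AE)
      show "AE w in mu \<alpha> \<beta>. ennreal (norm (f w) powr p * ?H w powr (1 - p) * 1) \<le>
        ennreal (norm (f w) powr p * ?H w powr (1 - p) * (1 - (norm w)\<^sup>2) powr (- (\<alpha> - a + t * (p - 1))))"
        using AE_mu_nonzero[OF \<alpha> \<beta>]
      proof eventually_elim
        case (elim w)
        then have "0 < (norm w)\<^sup>2" "(norm w)\<^sup>2 < 1" by (auto simp: abs_square_less_1)
        \<comment> \<open>The exponent \<alpha>-a+t(p-1) is positive by the lower bound on t(p-1),
          so inserting this factor, which is at least 1, only enlarges the integral.\<close>
        then have "1 powr (- (\<alpha> - a + t * (p - 1))) \<le> (1 - (norm w)\<^sup>2) powr (- (\<alpha> - a + t * (p - 1)))"
          using t by (intro powr_mono2') auto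
        then show ?case by (intro ennreal_leI mult_left_mono) auto
      qed
    qed
    also note schur_weight_integral_le[OF f]
    also have "ennreal (Beta (a + 1) (b + 1) / Beta (\<alpha> + 1) (\<beta> + 1)) * (\<integral>\<^sup>+w. ennreal (norm (f w) powr p) \<partial>mu a b) < \<infinity>"
      unfolding Lp_space_nn_integral[OF assms] by (simp add: ennreal_mult_less_top)
    finally show ?thesis using 1 by simp
  qed
  finally show ?thesis by simp
qed

lemma integrable_berezin_integrand:
  assumes "f \<in> Lp_space (mu a b) p" "norm z < 1"
  shows "integrable (mu \<alpha> \<beta>) (berezin_integrand \<alpha> \<beta> f z)"
proof (rule integrableI_bounded)
  have [measurable]: "f \<in> borel_measurable (mu \<alpha> \<beta>)"
    using Lp_space_measurable[OF assms(1)] by simp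
  have [measurable]: "Q z \<in> borel_measurable (mu \<alpha> \<beta>)"
    by (rule borel_measurable_muI[OF borel_measurable_Q2])
  show "berezin_integrand \<alpha> \<beta> f z \<in> borel_measurable (mu \<alpha> \<beta>)"
    unfolding berezin_integrand_eq[OF assms(2), abs_def] by measurable
  have "(\<integral>\<^sup>+w. ennreal (norm (berezin_integrand \<alpha> \<beta> f z w)) \<partial>mu \<alpha> \<beta>) \<le>
      (\<integral>\<^sup>+w. ennreal ((diag (norm z))\<^sup>2) * ennreal (norm (f w)) \<partial>mu \<alpha> \<beta>)"
  proof (rule nn_integral_mono)
    fix w assume "w \<in> space (mu \<alpha> \<beta>)"
    then have "norm w < 1" by simp
    then have "norm (f w) * Q z w \<le> norm (f w) * (diag (norm z))\<^sup>2"
      using Q_le[OF assms(2)] by (intro mult_left_mono) auto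
    then have "ennreal (norm (f w) * Q z w) \<le> ennreal ((diag (norm z))\<^sup>2 * norm (f w))"
      by (intro ennreal_leI) (simp add: mult.commute)
    then show "ennreal (norm (berezin_integrand \<alpha> \<beta> f z w)) \<le> ennreal ((diag (norm z))\<^sup>2) * ennreal (norm (f w))"
      using Q_nonneg[OF assms(2), of w]
      by (simp add: berezin_integrand_eq[OF assms(2)] norm_mult ennreal_mult)
  qed
  also have "\<dots> = ennreal ((diag (norm z))\<^sup>2) * (\<integral>\<^sup>+w. ennreal (norm (f w)) \<partial>mu \<alpha> \<beta>)"
    by (rule nn_integral_cmult) measurable
  also have "\<dots> < \<infinity>"
    using Lp_space_imp_finite_nn_integral[OF assms(1)] by (simp add: ennreal_mult_less_top)
  finally show "(\<integral>\<^sup>+w. ennreal (norm (berezin_integrand \<alpha> \<beta> f z w)) \<partial>mu \<alpha> \<beta>) < \<infinity>" .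
qed

text \<open>First half of Schur's test: Hoelder's inequality with respect to Q z w dmu(w). The row
  bound enters with the power p - 1, which produces the factor (1-|z|^2)^(-t(p-1)) that the column
  bound has to integrate.\<close>

lemma berezin_powr_le:
  obtains \<kappa> where "\<kappa> > 0" "\<And>f z. f \<in> Lp_space (mu a b) p \<Longrightarrow> norm z < 1 \<Longrightarrow>
    ennreal (norm (berezin \<alpha> \<beta> f z) powr p) \<le> ennreal (\<kappa> * (1 - (norm z)\<^sup>2) powr (- (t * (p - 1)))) *
      (\<integral>\<^sup>+w. ennreal (norm (f w) powr p * beta_weight (1 - t) (1 - s) ((norm w)\<^sup>2) powr (1 - p) * Q z w) \<partial>mu \<alpha> \<beta>)"
proof -
  let ?H = "\<lambda>w. beta_weight (1 - t) (1 - s) ((norm (w::complex))\<^sup>2)"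
  obtain C where C: "C > 0" "\<And>z. norm z < 1 \<Longrightarrow>
      (\<integral>\<^sup>+w. ennreal (?H w * Q z w) \<partial>mu \<alpha> \<beta>) \<le> ennreal (C * (1 - (norm z)\<^sup>2) powr (- t))"
    by (rule kernel_row_bound[OF s(1) t(1,2)]) blast
  show ?thesis
  proof (rule that[of "2 powr p * C powr (p - 1)"])
    fix f z assume f: "f \<in> Lp_space (mu a b) p" and z: "norm (z::complex) < 1"
    then have x: "0 < 1 - (norm z)\<^sup>2" by (simp add: abs_square_less_1)
    have [measurable]: "f \<in> borel_measurable (mu \<alpha> \<beta>)"
      using Lp_space_measurable[OF f] by simp
    let ?G = "\<integral>\<^sup>+w. ennreal (norm (f w) powr p * ?H w powr (1 - p) * Q z w) \<partial>mu \<alpha> \<beta>"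
    let ?k = "2 powr p * C powr (p - 1) * (1 - (norm z)\<^sup>2) powr (- (t * (p - 1)))"
    show "ennreal (norm (berezin \<alpha> \<beta> f z) powr p) \<le> ennreal ?k * ?G"
    proof (cases "?G = \<infinity>")
      case True
      have k: "?k > 0" using C(1) x by simp
      have top: "ennreal k * top = top" if "k > 0" for k
        using that by (simp add: ennreal_mult_top)
      show ?thesis unfolding True infinity_ennreal_def top[OF k] by simp
    next
      case False
      then obtain G where G: "?G = ennreal G" "G \<ge> 0" by (cases ?G) auto
      let ?N = "C * (1 - (norm z)\<^sup>2) powr (- t)"
      have N: "?N > 0" using C(1) x by simp
      have H: "?H \<in> borel_measurable (mu \<alpha> \<beta>)" by (rule borel_measurable_muI) measurable
      have Hpos: "AE w in mu \<alpha> \<beta>. ?H w > 0 \<and> Q z w \<ge> 0"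
        using AE_mu_nonzero[OF \<alpha> \<beta>]
        by eventually_elim (use Q_nonneg[OF z] in \<open>auto simp: beta_weight_def abs_square_less_1 less_imp_neq\<close>)
      have "ennreal (norm (berezin \<alpha> \<beta> f z)) \<le> (\<integral>\<^sup>+w. ennreal (norm (berezin_integrand \<alpha> \<beta> f z w)) \<partial>mu \<alpha> \<beta>)"
        unfolding berezin_def by (rule integral_norm_bound_ennreal[OF integrable_berezin_integrand[OF f z]])
      also have "\<dots> = (\<integral>\<^sup>+w. ennreal (norm (f w) * Q z w) \<partial>mu \<alpha> \<beta>)"
        using Q_nonneg[OF z] by (simp add: berezin_integrand_eq[OF z] norm_mult)
      also have "\<dots> \<le> ennreal (2 * ?N powr (1 - 1 / p) * G powr (1 / p))"
        by (rule nn_integral_weighted_Holder[OF _ H borel_measurable_muI[OF borel_measurable_Q2] _ Hpos p N C(2)[OF z] G(2,1)]) auto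
      finally have "norm (berezin \<alpha> \<beta> f z) \<le> 2 * ?N powr (1 - 1 / p) * G powr (1 / p)"
        by (subst (asm) ennreal_le_iff) auto
      then have "norm (berezin \<alpha> \<beta> f z) powr p \<le> (2 * ?N powr (1 - 1 / p) * G powr (1 / p)) powr p"
        using p by (intro powr_mono2) auto
      also have "\<dots> = 2 powr p * ?N powr ((1 - 1 / p) * p) * G powr ((1 / p) * p)"
        by (simp only: powr_mult powr_powr mult.assoc)
      also have "(1 - 1 / p) * p = p - 1" using p by (simp add: field_simps)
      also have "(1 / p) * p = 1" using p by simp
      also have "?N powr (p - 1) = C powr (p - 1) * (1 - (norm z)\<^sup>2) powr (- (t * (p - 1)))"
        by (simp add: powr_mult powr_powr)
      finally have "norm (berezin \<alpha> \<beta> f z) powr p \<le> ?k * G"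
        using G(2) by (simp add: mult_ac)
      then have "ennreal (norm (berezin \<alpha> \<beta> f z) powr p) \<le> ennreal (?k * G)"
        by (rule ennreal_leI)
      then show ?thesis unfolding G(1) by (simp add: ennreal_mult G(2))
    qed
  qed (use C(1) in simp)
qed

text \<open>Second half of Schur's test: after the exchange of integrals the z-integral is a column
  integral with r = t(p-1), and the remaining weight in w is dominated by the density of
  \<open>mu a b\<close>. Everything is nonnegative, so membership of the image in the space comes
  out together with the bound.\<close>

lemma berezin_nn_integral_le:
  obtains C where "C > 0" "\<And>f. f \<in> Lp_space (mu a b) p \<Longrightarrow>
    (\<integral>\<^sup>+z. ennreal (norm (berezin \<alpha> \<beta> f z) powr p) \<partial>mu a b) \<le>
      ennreal C * (\<integral>\<^sup>+w. ennreal (norm (f w) powr p) \<partial>mu a b)"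
proof -
  let ?H = "\<lambda>w. beta_weight (1 - t) (1 - s) ((norm (w::complex))\<^sup>2)"
  let ?r = "t * (p - 1)"
  obtain \<kappa> where \<kappa>: "\<kappa> > 0" "\<And>f z. f \<in> Lp_space (mu a b) p \<Longrightarrow> norm z < 1 \<Longrightarrow>
    ennreal (norm (berezin \<alpha> \<beta> f z) powr p) \<le> ennreal (\<kappa> * (1 - (norm z)\<^sup>2) powr (- ?r)) *
      (\<integral>\<^sup>+w. ennreal (norm (f w) powr p * ?H w powr (1 - p) * Q z w) \<partial>mu \<alpha> \<beta>)"
    by (rule berezin_powr_le) blast
  obtain C where C: "C > 0" "\<And>w. norm w < 1 \<Longrightarrow>
    (\<integral>\<^sup>+z. ennreal ((1 - (norm z)\<^sup>2) powr (- ?r) * Q z w) \<partial>mu a b) \<le>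
    ennreal (C * (1 - (norm w)\<^sup>2) powr (- (\<alpha> - a + ?r)))"
    by (rule kernel_column_bound[OF ab t(3,4)]) blast
  have B: "Beta (\<alpha> + 1) (\<beta> + 1) > 0" "Beta (a + 1) (b + 1) > 0"
    using \<alpha> \<beta> ab by (auto intro: Beta_pos_real)
  interpret A: finite_measure "mu a b" by (rule finite_measure_mu[OF ab])
  interpret M: finite_measure "mu \<alpha> \<beta>" by (rule finite_measure_mu[OF \<alpha> \<beta>])
  interpret P: pair_sigma_finite "mu \<alpha> \<beta>" "mu a b" ..
  have [measurable]: "(\<lambda>(w, z). Q z w) \<in> borel_measurable (mu \<alpha> \<beta> \<Otimes>\<^sub>M mu a b)"
  proof (rule borel_measurable_pair_mu)
    show "(\<lambda>(w, z). Q z w) \<in> borel_measurable (borel \<Otimes>\<^sub>M borel)"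
      using measurable_compose[OF measurable_pair_swap' borel_measurable_Q] by (simp add: split_beta')
  qed
  have [measurable]: "(\<lambda>w. (norm w)\<^sup>2) \<in> borel_measurable (mu c d)" for c d
    by (rule borel_measurable_muI) measurable
  have Q1 [measurable]: "Q z \<in> borel_measurable (mu \<alpha> \<beta>)" for z
    by (rule borel_measurable_muI[OF borel_measurable_Q2])
  have Q2 [measurable]: "(\<lambda>z. Q z w) \<in> borel_measurable (mu a b)" for w
  proof (rule borel_measurable_muI)
    show "(\<lambda>z. Q z w) \<in> borel_measurable borel"
      using measurable_compose[OF measurable_Pair2' borel_measurable_Q, of w] by simp
  qed
  show ?thesis
  proof (rule that[of "\<kappa> * C * (Beta (a + 1) (b + 1) / Beta (\<alpha> + 1) (\<beta> + 1))"])
    fix f assume f: "f \<in> Lp_space (mu a b) p"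
    have fm: "f \<in> borel_measurable disk_area"
      using Lp_space_measurable[OF f] by simp
    then have [measurable]: "f \<in> borel_measurable (mu \<alpha> \<beta>)" by simp
    let ?A = "\<lambda>w. norm (f w) powr p * ?H w powr (1 - p)"
    let ?D = "\<lambda>z. (1 - (norm (z::complex))\<^sup>2) powr (- ?r)"
    have "(\<integral>\<^sup>+z. ennreal (norm (berezin \<alpha> \<beta> f z) powr p) \<partial>mu a b) \<le>
        (\<integral>\<^sup>+z. ennreal (\<kappa> * ?D z) * (\<integral>\<^sup>+w. ennreal (?A w * Q z w) \<partial>mu \<alpha> \<beta>) \<partial>mu a b)"
      by (intro nn_integral_mono \<kappa>(2)[OF f]) simp
    also have "\<dots> = (\<integral>\<^sup>+z. (\<integral>\<^sup>+w. ennreal (\<kappa> * ?D z) * ennreal (?A w * Q z w) \<partial>mu \<alpha> \<beta>) \<partial>mu a b)"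
      by (intro nn_integral_cong nn_integral_cmult[symmetric]) measurable
    also have "\<dots> = (\<integral>\<^sup>+w. (\<integral>\<^sup>+z. ennreal (\<kappa> * ?D z) * ennreal (?A w * Q z w) \<partial>mu a b) \<partial>mu \<alpha> \<beta>)"
      by (rule P.Fubini') measurable
    also have "\<dots> = (\<integral>\<^sup>+w. ennreal (\<kappa> * ?A w) * (\<integral>\<^sup>+z. ennreal (?D z * Q z w) \<partial>mu a b) \<partial>mu \<alpha> \<beta>)"
    proof (rule nn_integral_cong)
      fix w
      have "(\<integral>\<^sup>+z. ennreal (\<kappa> * ?D z) * ennreal (?A w * Q z w) \<partial>mu a b) =
          (\<integral>\<^sup>+z. ennreal (\<kappa> * ?A w) * ennreal (?D z * Q z w) \<partial>mu a b)"
        using \<kappa>(1) Q_nonneg by (intro nn_integral_cong) (simp add: ennreal_mult[symmetric] mult_ac)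
      also have "\<dots> = ennreal (\<kappa> * ?A w) * (\<integral>\<^sup>+z. ennreal (?D z * Q z w) \<partial>mu a b)"
        by (rule nn_integral_cmult) measurable
      finally show "(\<integral>\<^sup>+z. ennreal (\<kappa> * ?D z) * ennreal (?A w * Q z w) \<partial>mu a b) =
          ennreal (\<kappa> * ?A w) * (\<integral>\<^sup>+z. ennreal (?D z * Q z w) \<partial>mu a b)" .
    qed
    also have "\<dots> \<le> (\<integral>\<^sup>+w. ennreal (\<kappa> * ?A w) * ennreal (C * (1 - (norm w)\<^sup>2) powr (- (\<alpha> - a + ?r))) \<partial>mu \<alpha> \<beta>)"
      by (intro nn_integral_mono mult_left_mono C(2)) auto
    also have "\<dots> = (\<integral>\<^sup>+w. ennreal (\<kappa> * C) * ennreal (?A w * (1 - (norm w)\<^sup>2) powr (- (\<alpha> - a + ?r))) \<partial>mu \<alpha> \<beta>)"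
      using \<kappa>(1) C(1) by (intro nn_integral_cong) (simp add: ennreal_mult[symmetric] mult_ac)
    also have "\<dots> = ennreal (\<kappa> * C) * (\<integral>\<^sup>+w. ennreal (?A w * (1 - (norm w)\<^sup>2) powr (- (\<alpha> - a + ?r))) \<partial>mu \<alpha> \<beta>)"
      by (rule nn_integral_cmult) measurable
    also have "\<dots> \<le> ennreal (\<kappa> * C) * (ennreal (Beta (a + 1) (b + 1) / Beta (\<alpha> + 1) (\<beta> + 1)) *
        (\<integral>\<^sup>+w. ennreal (norm (f w) powr p) \<partial>mu a b))"
      by (intro mult_left_mono schur_weight_integral_le fm) auto
    also have "\<dots> = ennreal (\<kappa> * C * (Beta (a + 1) (b + 1) / Beta (\<alpha> + 1) (\<beta> + 1))) *
        (\<integral>\<^sup>+w. ennreal (norm (f w) powr p) \<partial>mu a b)"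
      using \<kappa>(1) C(1) B by (subst ennreal_mult) (auto simp: mult.assoc)
    finally show "(\<integral>\<^sup>+z. ennreal (norm (berezin \<alpha> \<beta> f z) powr p) \<partial>mu a b) \<le>
        ennreal (\<kappa> * C * (Beta (a + 1) (b + 1) / Beta (\<alpha> + 1) (\<beta> + 1))) *
          (\<integral>\<^sup>+w. ennreal (norm (f w) powr p) \<partial>mu a b)" .
  qed (use \<kappa>(1) C(1) B in simp)
qed

lemma borel_measurable_berezin:
  assumes "f \<in> Lp_space (mu a b) p"
  shows "berezin \<alpha> \<beta> f \<in> borel_measurable (mu a b)"
proof -
  interpret M: finite_measure "mu \<alpha> \<beta>" by (rule finite_measure_mu[OF \<alpha> \<beta>])
  have [measurable]: "f \<in> borel_measurable (mu \<alpha> \<beta>)"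
    using Lp_space_measurable[OF assms] by simp
  have [measurable]: "case_prod Q \<in> borel_measurable (mu a b \<Otimes>\<^sub>M mu \<alpha> \<beta>)"
    by (rule borel_measurable_pair_mu[OF borel_measurable_Q])
  have "(\<lambda>z. \<integral>w. f w * of_real (Q z w) \<partial>mu \<alpha> \<beta>) \<in> borel_measurable (mu a b)"
    by (rule M.borel_measurable_lebesgue_integral) measurable
  \<comment> \<open>The formula with \<open>Q\<close> holds on the disk, which is the whole space of
    the measure; this suffices for measurability.\<close>
  moreover have eq: "berezin \<alpha> \<beta> f z = (\<integral>w. f w * of_real (Q z w) \<partial>mu \<alpha> \<beta>)" if "z \<in> space (mu a b)" for z
  proof -
    have "norm z < 1" using that by simp
    then have "berezin_integrand \<alpha> \<beta> f z = (\<lambda>w. f w * of_real (Q z w))"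
      using berezin_integrand_eq by blast
    then show ?thesis by (simp only: berezin_def)
  qed
  moreover have "berezin \<alpha> \<beta> f \<in> borel_measurable (mu a b) \<longleftrightarrow>
      (\<lambda>z. \<integral>w. f w * of_real (Q z w) \<partial>mu \<alpha> \<beta>) \<in> borel_measurable (mu a b)"
    by (rule measurable_cong[OF eq])
  ultimately show ?thesis by simp
qed

lemma berezin_bounded_if_schur_exponents: "berezin_bounded \<alpha> \<beta> a b p"
  unfolding berezin_bounded_def bounded_linear_on_Lp_def
proof (intro conjI ballI allI impI)
  show "integrable (mu \<alpha> \<beta>) (berezin_integrand \<alpha> \<beta> f z)"
    if "f \<in> Lp_space (mu a b) p" "z \<in> ball 0 1" for f z
    using that by (intro integrable_berezin_integrand) auto
  note int = integrable_berezin_integrand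
  obtain C where C: "C > 0" "\<And>f. f \<in> Lp_space (mu a b) p \<Longrightarrow>
    (\<integral>\<^sup>+z. ennreal (norm (berezin \<alpha> \<beta> f z) powr p) \<partial>mu a b) \<le>
      ennreal C * (\<integral>\<^sup>+w. ennreal (norm (f w) powr p) \<partial>mu a b)"
    by (rule berezin_nn_integral_le) blast
  show Lp: "berezin \<alpha> \<beta> f \<in> Lp_space (mu a b) p" if f: "f \<in> Lp_space (mu a b) p" for f
  proof -
    have [measurable]: "berezin \<alpha> \<beta> f \<in> borel_measurable (mu a b)"
      by (rule borel_measurable_berezin[OF f])
    have "(\<integral>\<^sup>+z. ennreal (norm (berezin \<alpha> \<beta> f z) powr p) \<partial>mu a b) < \<infinity>"
      using C(2)[OF f] unfolding Lp_space_nn_integral[OF f]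
      by (rule le_less_trans) (simp add: ennreal_mult_less_top)
    then have "integrable (mu a b) (\<lambda>z. norm (berezin \<alpha> \<beta> f z) powr p)"
      by (intro integrableI_bounded) auto
    then show ?thesis by (simp add: Lp_space_def)
  qed
  show "AE z in mu a b. berezin \<alpha> \<beta> f z = berezin \<alpha> \<beta> g z"
    if f: "f \<in> Lp_space (mu a b) p" and g: "g \<in> Lp_space (mu a b) p" and eq: "AE x in mu a b. f x = g x" for f g
  proof (rule AE_I2)
    fix z assume "z \<in> space (mu a b)"
    then have z: "norm z < 1" by simp
    \<comment> \<open>Both measures have the null sets of area, so equality almost everywhere passes
      from one to the other. The transforms then agree at every point of the disk.\<close>
    have "AE x in mu \<alpha> \<beta>. f x = g x"
      using eq unfolding AE_mu_iff[OF ab] AE_mu_iff[OF \<alpha> \<beta>] .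
    then have "AE x in mu \<alpha> \<beta>. berezin_integrand \<alpha> \<beta> f z x = berezin_integrand \<alpha> \<beta> g z x"
      by eventually_elim (simp add: berezin_integrand_def)
    then show "berezin \<alpha> \<beta> f z = berezin \<alpha> \<beta> g z" unfolding berezin_def
      using int[OF f z] int[OF g z] by (intro integral_cong_AE) auto
  qed
  show "AE z in mu a b. berezin \<alpha> \<beta> (\<lambda>y. f y + g y) z = berezin \<alpha> \<beta> f z + berezin \<alpha> \<beta> g z"
    if f: "f \<in> Lp_space (mu a b) p" and g: "g \<in> Lp_space (mu a b) p" for f g
  proof (rule AE_I2)
    fix z assume "z \<in> space (mu a b)"
    then have z: "norm z < 1" by simp
    have "berezin_integrand \<alpha> \<beta> (\<lambda>y. f y + g y) z = (\<lambda>w. berezin_integrand \<alpha> \<beta> f z w + berezin_integrand \<alpha> \<beta> g z w)"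
      by (rule ext) (simp only: berezin_integrand_def distrib_right)
    then show "berezin \<alpha> \<beta> (\<lambda>y. f y + g y) z = berezin \<alpha> \<beta> f z + berezin \<alpha> \<beta> g z"
      unfolding berezin_def using int[OF f z] int[OF g z] by (simp add: Bochner_Integration.integral_add)
  qed
  show "AE z in mu a b. berezin \<alpha> \<beta> (\<lambda>y. c * f y) z = c * berezin \<alpha> \<beta> f z"
    if f: "f \<in> Lp_space (mu a b) p" for f c
  proof (rule AE_I2)
    fix z
    have "berezin_integrand \<alpha> \<beta> (\<lambda>y. c * f y) z = (\<lambda>w. c * berezin_integrand \<alpha> \<beta> f z w)"
      by (simp add: berezin_integrand_def fun_eq_iff)
    then show "berezin \<alpha> \<beta> (\<lambda>y. c * f y) z = c * berezin \<alpha> \<beta> f z"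
      unfolding berezin_def by simp
  qed
  show "\<exists>C. \<forall>f\<in>Lp_space (mu a b) p. Lp_norm (mu a b) p (berezin \<alpha> \<beta> f) \<le> C * Lp_norm (mu a b) p f"
  proof (intro exI ballI)
    fix f assume f: "f \<in> Lp_space (mu a b) p"
    have "ennreal (\<integral>z. norm (berezin \<alpha> \<beta> f z) powr p \<partial>mu a b) \<le> ennreal (C * (\<integral>z. norm (f z) powr p \<partial>mu a b))"
      using C(2)[OF f] C(1) unfolding Lp_space_nn_integral[OF f] Lp_space_nn_integral[OF Lp[OF f]]
      by (simp add: ennreal_mult)
    then have "(\<integral>z. norm (berezin \<alpha> \<beta> f z) powr p \<partial>mu a b) \<le> C * (\<integral>z. norm (f z) powr p \<partial>mu a b)"
      using C(1) by (subst (asm) ennreal_le_iff) (auto intro!: mult_nonneg_nonneg)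
    then have "Lp_norm (mu a b) p (berezin \<alpha> \<beta> f) \<le> (C * (\<integral>z. norm (f z) powr p \<partial>mu a b)) powr (1 / p)"
      unfolding Lp_norm_def using p by (intro powr_mono2) auto
    also have "\<dots> = C powr (1 / p) * Lp_norm (mu a b) p f"
      by (simp add: Lp_norm_def powr_mult)
    finally show "Lp_norm (mu a b) p (berezin \<alpha> \<beta> f) \<le> C powr (1 / p) * Lp_norm (mu a b) p f" .
  qed
qed

end

theorem berezin_bounded_sufficient:
  assumes ab: "- 1 < a" "- 1 < b" and p: "1 \<le> p"
    and 1: "p * (\<alpha> + 1) > a + 1" and 2: "if p = 1 then b \<le> \<beta> else b < p * (\<beta> + 1) - 1"
  shows "berezin_bounded \<alpha> \<beta> a b p"
proof (cases "p = 1")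
  case True
  show ?thesis
    \<comment> \<open>For p = 1 the products with p - 1 vanish, so s = t = 0 is admissible and the
      conditions become a < \<alpha> and b \<le> \<beta>.\<close>
    by (rule berezin_bounded_if_schur_exponents[of a b p 0 0]) (use assms True \<alpha> \<beta> in auto)
next
  case False
  then have p1: "p - 1 > 0" using p by simp
  \<comment> \<open>The smallest s allowed by the comparison of weights; s < \<beta>+1 is then
    equivalent to b < p(\<beta>+1)-1.\<close>
  define s where "s = (b - \<beta>) / (p - 1)"
  have s: "s * (p - 1) = b - \<beta>" "s < \<beta> + 1"
    unfolding s_def using p1 2 False by (simp, simp add: pos_divide_less_eq algebra_simps)
  define L where "L = max (- (\<alpha> + 2)) ((a - \<alpha>) / (p - 1))"
  define U where "U = min (\<alpha> + 1) ((a + \<alpha> + 3) / (p - 1))"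
  \<comment> \<open>A rewriting of p(\<alpha>+1) > a+1. The other comparisons that make the interval
    (L, U) nonempty follow from \<alpha>, a > -1.\<close>
  have "(a - \<alpha>) / (p - 1) < \<alpha> + 1"
    using p1 1 by (simp add: pos_divide_less_eq algebra_simps)
  moreover have "(a - \<alpha>) / (p - 1) < (a + \<alpha> + 3) / (p - 1)"
    using p1 \<alpha> by (intro divide_strict_right_mono) auto
  moreover have "(a + \<alpha> + 3) / (p - 1) > 0" using p1 \<alpha> ab by (intro divide_pos_pos) auto
  ultimately have "L < U" using \<alpha> by (auto simp: L_def U_def)
  then obtain t where t: "L < t" "t < U" using dense by blast
  then have "- (\<alpha> + 2) < t" "(a - \<alpha>) / (p - 1) < t" "t < \<alpha> + 1" "t < (a + \<alpha> + 3) / (p - 1)"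
    by (simp_all add: L_def U_def)
  then show ?thesis using p1 s ab p
    by (intro berezin_bounded_if_schur_exponents[of a b p s t])
      (simp_all add: pos_divide_less_eq pos_less_divide_eq)
qed

end

subsection \<open>Necessity: power test functions\<close>


lemma beta_weight_powr:
  "beta_weight u v x powr p = beta_weight (p * (u - 1) + 1) (p * (v - 1) + 1) x"
  by (simp add: beta_weight_def powr_mult powr_powr mult.commute)

lemma nn_integral_mu_beta_weight:
  assumes ab: "- 1 < a" "- 1 < b" and u: "a + u > 0" and v: "b + v > 0"
  shows "(\<integral>\<^sup>+w. ennreal (beta_weight u v ((norm w)\<^sup>2)) \<partial>mu a b) =
    ennreal (Beta (a + u) (b + v) / Beta (a + 1) (b + 1))"
proof -
  have B: "Beta (a + 1) (b + 1) > 0" using ab by (intro Beta_pos_real) auto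
  let ?g = "\<lambda>x. ennreal (1 / Beta (a + 1) (b + 1)) * (ennreal (x ^ 0) * ennreal (beta_weight (a + u) (b + v) x))"
  have "(\<integral>\<^sup>+w. ennreal (beta_weight u v ((norm w)\<^sup>2)) \<partial>mu a b) =
      (\<integral>\<^sup>+w. ennreal (beta_weight (a + 1) (b + 1) ((norm w)\<^sup>2) / Beta (a + 1) (b + 1)) *
        ennreal (beta_weight u v ((norm w)\<^sup>2)) \<partial>disk_area)"
    by (intro nn_integral_mu borel_measurable_disk_areaI) measurable
  also have "\<dots> = (\<integral>\<^sup>+w. ?g ((norm w)\<^sup>2) \<partial>disk_area)"
  proof (rule nn_integral_cong)
    fix w :: complex
    have "beta_weight (a + 1) (b + 1) ((norm w)\<^sup>2) * beta_weight u v ((norm w)\<^sup>2) =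
        beta_weight (a + u) (b + v) ((norm w)\<^sup>2)"
      unfolding beta_weight_mult by (simp add: algebra_simps)
    then show "ennreal (beta_weight (a + 1) (b + 1) ((norm w)\<^sup>2) / Beta (a + 1) (b + 1)) *
        ennreal (beta_weight u v ((norm w)\<^sup>2)) = ?g ((norm w)\<^sup>2)"
      using B by (simp add: ennreal_mult[symmetric])
  qed
  also have "\<dots> = (\<integral>\<^sup>+x. indicator {0..1} x * ?g x \<partial>lborel)"
    by (rule nn_integral_disk_radial) measurable
  also have "\<dots> = (\<integral>\<^sup>+x. ennreal (1 / Beta (a + 1) (b + 1)) *
      (indicator {0..1} x * (ennreal (x ^ 0) * ennreal (beta_weight (a + u) (b + v) x))) \<partial>lborel)"
    by (simp add: mult_ac)
  also have "\<dots> = ennreal (1 / Beta (a + 1) (b + 1)) * ennreal (Beta (a + u) (b + v + real 0))"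
    unfolding nn_integral_beta_weight[OF u v, symmetric] by (rule nn_integral_cmult) measurable
  also have "\<dots> = ennreal (Beta (a + u) (b + v) / Beta (a + 1) (b + 1))"
    using B Beta_pos_real[OF u v] by (simp add: ennreal_mult[symmetric])
  finally show ?thesis .
qed

text \<open>After multiplication by e the left side tends to 1. The right side tends to 0: for d > 0
  the Beta value stays bounded, and for d = 0 it grows like (p e)^(-1/p), which is o(1/e) because p
  > 1. The limit is computed for the p-th powers, where the pole appears linearly.\<close>

lemma no_Beta_blowup_bound:
  fixes x y d p K :: real
  assumes pos: "x > 0" "y > 0" and p: "p \<ge> 1" and d: "d \<ge> 0" "d > 0 \<or> p > 1"
    and le: "\<And>e. e > 0 \<Longrightarrow> Beta e x \<le> K * Beta (d + p * e) y powr (1 / p)"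
  shows False
proof -
  have id: "((\<lambda>e::real. e) \<longlongrightarrow> 0) (at_right 0)" by (rule tendsto_ident_at)
  have pw: "((\<lambda>e::real. e powr q) \<longlongrightarrow> 0) (at_right 0)" if "q > 0" for q
    by (rule tendsto_zero_powrI[OF id tendsto_const])
      (use that in \<open>auto simp: eventually_at_filter\<close>)
  have "((\<lambda>e. e powr p * Beta (d + p * e) y) \<longlongrightarrow> 0) (at_right 0)"
  proof (cases "d = 0")
    case True
    then have p1: "p > 1" using d by simp
    have "filterlim (\<lambda>e. p * e) (at_right 0) (at_right (0::real))"
      by (rule filterlim_times_pos[of _ 0]) (use p in \<open>auto simp: filterlim_ident\<close>)
    from filterlim_compose[OF tendsto_mult_Beta_at_right_0[OF pos(2)] this]
    have "((\<lambda>e. (p * e) * Beta (p * e) y) \<longlongrightarrow> 1) (at_right 0)" .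
    then have "((\<lambda>e. (1 / p) * (e powr (p - 1) * ((p * e) * Beta (p * e) y))) \<longlongrightarrow> (1 / p) * (0 * 1)) (at_right 0)"
      using p1 by (intro tendsto_mult tendsto_const pw) auto
    moreover have "\<forall>\<^sub>F e in at_right 0. (1 / p) * (e powr (p - 1) * ((p * e) * Beta (p * e) y)) = e powr p * Beta (d + p * e) y"
      unfolding eventually_at_filter
      by (rule always_eventually) (use p True in \<open>auto simp: powr_diff\<close>)
    ultimately show ?thesis by (simp add: filterlim_cong)
  next
    case False
    then have "d > 0" using d by simp
    have "((\<lambda>e. Gamma (d + p * e) * Gamma y / Gamma (d + p * e + y)) \<longlongrightarrow>
        Gamma (d + p * 0) * Gamma y / Gamma (d + p * 0 + y)) (at_right 0)"
      using \<open>d > 0\<close> pos Gamma_real_pos[of "d + y"]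
      by (intro tendsto_intros) (auto elim!: nonpos_Ints_cases simp del: Gamma_real_pos)
    then have "((\<lambda>e. e powr p * (Gamma (d + p * e) * Gamma y / Gamma (d + p * e + y))) \<longlongrightarrow>
        0 * (Gamma (d + p * 0) * Gamma y / Gamma (d + p * 0 + y))) (at_right 0)"
      using p by (intro tendsto_mult pw) auto
    then show ?thesis by (simp add: Beta_def)
  qed
  then have "((\<lambda>e. (e powr p * Beta (d + p * e) y) powr (1 / p)) \<longlongrightarrow> 0) (at_right 0)"
  proof (rule tendsto_zero_powrI[OF _ tendsto_const])
    show "\<forall>\<^sub>F e in at_right 0. 0 \<le> e powr p * Beta (d + p * e) y"
      unfolding eventually_at_filter using p d pos
      by (intro always_eventually) (auto intro!: mult_nonneg_nonneg less_imp_le[OF Beta_pos_real] add_nonneg_pos)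
  qed (use p in simp)
  then have lim: "((\<lambda>e. K * (e powr p * Beta (d + p * e) y) powr (1 / p)) \<longlongrightarrow> K * 0) (at_right 0)"
    by (intro tendsto_mult tendsto_const)
  have "(1::real) \<le> K * 0"
  proof (rule tendsto_le[OF _ lim tendsto_mult_Beta_at_right_0[OF pos(1)]])
    show "\<forall>\<^sub>F e in at_right 0. e * Beta e x \<le> K * (e powr p * Beta (d + p * e) y) powr (1 / p)"
      unfolding eventually_at_filter
    proof (intro always_eventually allI impI)
      fix e :: real assume "e \<in> {0<..}"
      then have e: "e > 0" by simp
      have "(e powr p * Beta (d + p * e) y) powr (1 / p) = e * Beta (d + p * e) y powr (1 / p)"
        using e p by (simp add: powr_mult powr_powr)
      then show "e * Beta e x \<le> K * (e powr p * Beta (d + p * e) y) powr (1 / p)"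
        using mult_left_mono[OF le[OF e], of e] e by (simp add: mult_ac)
    qed
  qed simp
  then show False by simp
qed

section \<open>Testing boundedness on radial powers\<close>

context kernel_parameters
begin

text \<open>Each application uses one singular factor: u = 1 leaves a pure power of |w|, v = 1 a
  pure power of 1 - |w|^2.\<close>

definition test_fun :: "real \<Rightarrow> real \<Rightarrow> complex \<Rightarrow> complex" where
  "test_fun u v w = of_real (beta_weight u v ((norm w)\<^sup>2))"

lemma borel_measurable_test_fun: "test_fun u v \<in> borel_measurable borel"
  unfolding test_fun_def[abs_def] by measurable

lemma norm_test_fun [simp]: "norm (test_fun u v w) = beta_weight u v ((norm w)\<^sup>2)"
  by (simp add: test_fun_def)

context
  fixes a b p :: real
  assumes ab: "- 1 < a" "- 1 < b" and p: "1 \<le> p"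
    and bounded: "berezin_bounded \<alpha> \<beta> a b p"
begin

lemma
  assumes "a + 1 + p * (u - 1) > 0" "b + 1 + p * (v - 1) > 0"
  shows test_fun_in_Lp: "test_fun u v \<in> Lp_space (mu a b) p"
    and integral_test_fun: "(\<integral>w. norm (test_fun u v w) powr p \<partial>mu a b) =
      Beta (a + 1 + p * (u - 1)) (b + 1 + p * (v - 1)) / Beta (a + 1) (b + 1)"
proof -
  have B: "Beta (a + 1) (b + 1) > 0" using ab by (intro Beta_pos_real) auto
  have eq: "(\<integral>\<^sup>+w. ennreal (norm (test_fun u v w) powr p) \<partial>mu a b) =
      ennreal (Beta (a + 1 + p * (u - 1)) (b + 1 + p * (v - 1)) / Beta (a + 1) (b + 1))"
    using nn_integral_mu_beta_weight[OF ab, of "p * (u - 1) + 1" "p * (v - 1) + 1"] assms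
    by (simp add: beta_weight_powr algebra_simps)
  have [measurable]: "test_fun u v \<in> borel_measurable (mu a b)"
    by (rule borel_measurable_muI[OF borel_measurable_test_fun])
  have "integrable (mu a b) (\<lambda>w. norm (test_fun u v w) powr p)"
    by (rule integrableI_bounded, measurable) (use eq in simp)
  then show *: "test_fun u v \<in> Lp_space (mu a b) p" by (simp add: Lp_space_def)
  show "(\<integral>w. norm (test_fun u v w) powr p \<partial>mu a b) =
      Beta (a + 1 + p * (u - 1)) (b + 1 + p * (v - 1)) / Beta (a + 1) (b + 1)"
    using eq Beta_pos_real[OF assms] B unfolding Lp_space_nn_integral[OF *]
    by (subst (asm) ennreal_inj) auto
qed

text \<open>Boundedness includes convergence of the integral; without it the Bochner integral would
  be 0 by convention. For a nonnegative integrand it then equals the nonnegative integral, whose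
  value is known as a series.\<close>

lemma norm_berezin_test_fun:
  assumes f: "test_fun u v \<in> Lp_space (mu a b) p" and z: "norm z < 1"
    and u: "\<alpha> + u > 0" and v: "\<beta> + v > 0"
  shows "ennreal (norm (berezin \<alpha> \<beta> (test_fun u v) z)) =
    ennreal (1 / diag ((norm z)\<^sup>2) / Beta (\<alpha> + 1) (\<beta> + 1)) *
      (\<Sum>n. ennreal ((coef n)\<^sup>2 * Beta (\<alpha> + u) (\<beta> + v + real n) * ((norm z)\<^sup>2) ^ n))"
proof -
  have int: "integrable (mu \<alpha> \<beta>) (berezin_integrand \<alpha> \<beta> (test_fun u v) z)"
    using bounded f z unfolding berezin_bounded_def by simp
  have eq: "berezin_integrand \<alpha> \<beta> (test_fun u v) z = (\<lambda>w. of_real (beta_weight u v ((norm w)\<^sup>2) * Q z w))"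
    by (rule ext) (simp add: berezin_integrand_eq[OF z] test_fun_def)
  have int': "integrable (mu \<alpha> \<beta>) (\<lambda>w. beta_weight u v ((norm w)\<^sup>2) * Q z w)"
    using int unfolding eq complex_of_real_integrable_eq .
  have nonneg: "0 \<le> beta_weight u v ((norm w)\<^sup>2) * Q z w" for w
    using Q_nonneg[OF z] by simp
  have "norm (berezin \<alpha> \<beta> (test_fun u v) z) = (\<integral>w. beta_weight u v ((norm w)\<^sup>2) * Q z w \<partial>mu \<alpha> \<beta>)"
    using nonneg unfolding berezin_def eq integral_complex_of_real by (simp add: integral_nonneg_AE)
  then have "ennreal (norm (berezin \<alpha> \<beta> (test_fun u v) z)) = (\<integral>\<^sup>+w. ennreal (beta_weight u v ((norm w)\<^sup>2) * Q z w) \<partial>mu \<alpha> \<beta>)"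
    using nn_integral_eq_integral[OF int'] nonneg by simp
  then show ?thesis unfolding nn_integral_Q_beta_weight[OF z u v] .
qed

lemma integral_berezin_le:
  obtains C where "C \<ge> 0" "\<And>f. f \<in> Lp_space (mu a b) p \<Longrightarrow>
    (\<integral>\<^sup>+z. ennreal (norm (berezin \<alpha> \<beta> f z) powr p) \<partial>mu a b) \<le> ennreal (C * (\<integral>w. norm (f w) powr p \<partial>mu a b))"
proof -
  obtain C where C: "\<And>f. f \<in> Lp_space (mu a b) p \<Longrightarrow> Lp_norm (mu a b) p (berezin \<alpha> \<beta> f) \<le> C * Lp_norm (mu a b) p f"
    using bounded unfolding berezin_bounded_def bounded_linear_on_Lp_def by blast
  show ?thesis
  \<comment> \<open>The constant in the definition is an arbitrary real; its absolute value makes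
    the p-th power monotone.\<close>
  proof (rule that[of "\<bar>C\<bar> powr p"])
    fix f assume f: "f \<in> Lp_space (mu a b) p"
    then have Bf: "berezin \<alpha> \<beta> f \<in> Lp_space (mu a b) p"
      using bounded unfolding berezin_bounded_def bounded_linear_on_Lp_def by blast
    have nn: "0 \<le> (\<integral>w. norm (h w) powr p \<partial>mu a b)" for h :: "complex \<Rightarrow> complex"
      by (rule integral_nonneg_AE) simp
    have "Lp_norm (mu a b) p (berezin \<alpha> \<beta> f) \<le> \<bar>C\<bar> * Lp_norm (mu a b) p f"
      using C[OF f] mult_right_mono[OF abs_ge_self[of C], of "Lp_norm (mu a b) p f"]
      by (simp add: Lp_norm_def)
    then have "Lp_norm (mu a b) p (berezin \<alpha> \<beta> f) powr p \<le> (\<bar>C\<bar> * Lp_norm (mu a b) p f) powr p"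
      using p by (intro powr_mono2) (auto simp: Lp_norm_def)
    then have "(\<integral>w. norm (berezin \<alpha> \<beta> f w) powr p \<partial>mu a b) \<le> \<bar>C\<bar> powr p * (\<integral>w. norm (f w) powr p \<partial>mu a b)"
      using p nn by (simp add: Lp_norm_def powr_mult powr_powr)
    then show "(\<integral>\<^sup>+z. ennreal (norm (berezin \<alpha> \<beta> f z) powr p) \<partial>mu a b) \<le>
        ennreal (\<bar>C\<bar> powr p * (\<integral>w. norm (f w) powr p \<partial>mu a b))"
      unfolding Lp_space_nn_integral[OF Bf] by (rule ennreal_leI)
  qed simp
qed

text \<open>The term n = 0 bounds the transform from below by
  \<open>Beta (\<alpha> + u) (\<beta> + v)\<close> times a function of z that does not involve u and
  v. Integrating this function gives the constant I > 0, so K is uniform in u and v and the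
  parameters may approach the edge of their range.\<close>

lemma Beta_le_of_bounded:
  obtains K where "\<And>u v. \<alpha> + u > 0 \<Longrightarrow> \<beta> + v > 0 \<Longrightarrow> a + 1 + p * (u - 1) > 0 \<Longrightarrow> b + 1 + p * (v - 1) > 0 \<Longrightarrow>
    Beta (\<alpha> + u) (\<beta> + v) \<le> K * Beta (a + 1 + p * (u - 1)) (b + 1 + p * (v - 1)) powr (1 / p)"
proof -
  have B: "Beta (\<alpha> + 1) (\<beta> + 1) > 0" "Beta (a + 1) (b + 1) > 0"
    using \<alpha> \<beta> ab by (auto intro: Beta_pos_real)
  obtain C where C: "C \<ge> 0" "\<And>f. f \<in> Lp_space (mu a b) p \<Longrightarrow>
    (\<integral>\<^sup>+z. ennreal (norm (berezin \<alpha> \<beta> f z) powr p) \<partial>mu a b) \<le> ennreal (C * (\<integral>w. norm (f w) powr p \<partial>mu a b))"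
    by (rule integral_berezin_le) blast
  interpret finite_measure "mu a b" by (rule finite_measure_mu[OF ab])
  let ?h = "\<lambda>z. (1 / diag ((norm (z::complex))\<^sup>2) / Beta (\<alpha> + 1) (\<beta> + 1)) powr p"
  have [measurable]: "?h \<in> borel_measurable (mu a b)" by (rule borel_measurable_muI) measurable
  have hint: "integrable (mu a b) ?h"
  proof (rule integrable_const_bound[of _ "(1 / Beta (\<alpha> + 1) (\<beta> + 1)) powr p"])
    show "AE z in mu a b. norm (?h z) \<le> (1 / Beta (\<alpha> + 1) (\<beta> + 1)) powr p"
    proof (rule AE_I2)
      fix z assume "z \<in> space (mu a b)"
      then have "diag ((norm z)\<^sup>2) \<ge> 1" by (intro diag_ge_1) (auto simp: abs_square_less_1)
      then have "1 / diag ((norm z)\<^sup>2) \<le> 1" "diag ((norm z)\<^sup>2) > 0" by simp_all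
      then have "?h z \<le> (1 / Beta (\<alpha> + 1) (\<beta> + 1)) powr p"
        using B p by (intro powr_mono2 divide_right_mono divide_nonneg_pos) auto
      then show "norm (?h z) \<le> (1 / Beta (\<alpha> + 1) (\<beta> + 1)) powr p" by simp
    qed
  qed measurable
  define I where "I = (\<integral>z. ?h z \<partial>mu a b)"
  \<comment> \<open>\<open>?h\<close> is strictly positive on the disk and \<open>mu a b\<close> has
    total mass 1.\<close>
  have "I \<noteq> 0"
  proof
    assume "I = 0"
    then have "AE z in mu a b. ?h z = 0"
      unfolding I_def by (subst (asm) integral_nonneg_eq_0_iff_AE[OF hint]) auto
    moreover have "AE z in mu a b. z \<in> space (mu a b)" by (rule AE_space)
    ultimately have "AE z in mu a b. False"
    proof eventually_elim
      case (elim z)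
      then have "norm z < 1" by simp
      then show False using elim(1) diag_pos[of z] B by simp
    qed
    then have 0: "emeasure (mu a b) (space (mu a b)) = 0"
      using emeasure_eq_0_AE[of "\<lambda>_. True" "mu a b"] by (simp del: space_mu)
    show False using emeasure_space_mu[OF ab] unfolding 0 by simp
  qed
  moreover have "I \<ge> 0" unfolding I_def by (rule integral_nonneg_AE) simp
  ultimately have I: "I > 0" by simp
  show ?thesis
  proof (rule that[of "(C / I / Beta (a + 1) (b + 1)) powr (1 / p)"])
    fix u v
    assume uv: "\<alpha> + u > 0" "\<beta> + v > 0" and uv': "a + 1 + p * (u - 1) > 0" "b + 1 + p * (v - 1) > 0"
    let ?T = "Beta (\<alpha> + u) (\<beta> + v)" and ?R = "Beta (a + 1 + p * (u - 1)) (b + 1 + p * (v - 1))"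
    have T: "?T > 0" using uv by (rule Beta_pos_real)
    note f = test_fun_in_Lp[OF uv']
    have le: "?h z * ?T powr p \<le> norm (berezin \<alpha> \<beta> (test_fun u v) z) powr p" if z: "norm z < 1" for z
    proof -
      let ?k = "1 / diag ((norm z)\<^sup>2) / Beta (\<alpha> + 1) (\<beta> + 1)"
      have k: "?k \<ge> 0" using B diag_pos[OF z] by simp
      have "ennreal (?k * ?T) = ennreal ?k * (\<Sum>n\<in>{0}. ennreal ((coef n)\<^sup>2 * Beta (\<alpha> + u) (\<beta> + v + real n) * ((norm z)\<^sup>2) ^ n))"
        unfolding ennreal_mult[OF k less_imp_le[OF T]] by simp
      also have "\<dots> \<le> ennreal ?k * (\<Sum>n. ennreal ((coef n)\<^sup>2 * Beta (\<alpha> + u) (\<beta> + v + real n) * ((norm z)\<^sup>2) ^ n))"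
        by (intro mult_left_mono sum_le_suminf summableI) auto
      also have "\<dots> = ennreal (norm (berezin \<alpha> \<beta> (test_fun u v) z))"
        by (rule norm_berezin_test_fun[OF f z uv, symmetric])
      finally have "?k * ?T \<le> norm (berezin \<alpha> \<beta> (test_fun u v) z)"
        by (subst (asm) ennreal_le_iff) auto
      then have "(?k * ?T) powr p \<le> norm (berezin \<alpha> \<beta> (test_fun u v) z) powr p"
        using k T p by (intro powr_mono2 mult_nonneg_nonneg) auto
      then show ?thesis by (simp only: powr_mult)
    qed
    have "ennreal (I * ?T powr p) = (\<integral>\<^sup>+z. ennreal (?h z * ?T powr p) \<partial>mu a b)"
      using hint by (subst nn_integral_eq_integral) (auto simp: I_def)
    also have "\<dots> \<le> (\<integral>\<^sup>+z. ennreal (norm (berezin \<alpha> \<beta> (test_fun u v) z) powr p) \<partial>mu a b)"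
      by (intro nn_integral_mono ennreal_leI le) simp
    also have "\<dots> \<le> ennreal (C * (?R / Beta (a + 1) (b + 1)))"
      using C(2)[OF f] unfolding integral_test_fun[OF uv'] .
    finally have "I * ?T powr p \<le> C * (?R / Beta (a + 1) (b + 1))"
      using C(1) B Beta_pos_real[OF uv'] by (subst (asm) ennreal_le_iff) auto
    then have "?T powr p \<le> C * (?R / Beta (a + 1) (b + 1)) / I"
      unfolding pos_le_divide_eq[OF I] mult.commute[of I] .
    also have "\<dots> = C / I / Beta (a + 1) (b + 1) * ?R" by simp
    finally have "?T powr p \<le> C / I / Beta (a + 1) (b + 1) * ?R" .
    then have "(?T powr p) powr (1 / p) \<le> (C / I / Beta (a + 1) (b + 1) * ?R) powr (1 / p)"
      using p by (intro powr_mono2) auto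
    then show "?T \<le> (C / I / Beta (a + 1) (b + 1)) powr (1 / p) * ?R powr (1 / p)"
      unfolding powr_mult using p T by (simp add: powr_powr)
  qed
qed

section \<open>Contradictions from violated exponent conditions\<close>

lemma necessary_b:
  assumes "b + 1 - p * (\<beta> + 1) \<ge> 0" "b + 1 - p * (\<beta> + 1) > 0 \<or> p > 1"
  shows False
proof (rule Beta_le_of_bounded)
  fix K assume K: "\<And>u v. \<alpha> + u > 0 \<Longrightarrow> \<beta> + v > 0 \<Longrightarrow> a + 1 + p * (u - 1) > 0 \<Longrightarrow> b + 1 + p * (v - 1) > 0 \<Longrightarrow>
    Beta (\<alpha> + u) (\<beta> + v) \<le> K * Beta (a + 1 + p * (u - 1)) (b + 1 + p * (v - 1)) powr (1 / p)"
  show False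
  proof (rule no_Beta_blowup_bound[of "\<alpha> + 1" "a + 1" p "b + 1 - p * (\<beta> + 1)" K])
    fix e :: real assume e: "e > 0"
    have eq: "b + 1 + p * (e - \<beta> - 1) = b + 1 - p * (\<beta> + 1) + p * e" by (simp add: algebra_simps)
    have "b + 1 - p * (\<beta> + 1) + p * e > 0"
      using e p assms(1) by (intro add_nonneg_pos mult_pos_pos) auto
    then show "Beta e (\<alpha> + 1) \<le> K * Beta (b + 1 - p * (\<beta> + 1) + p * e) (a + 1) powr (1 / p)"
      \<comment> \<open>The choice v = e-\<beta> places \<beta>+v at distance e from the pole, while
        u = 1 keeps the boundary parameters fixed.\<close>
      using K[of 1 "e - \<beta>"] e ab \<alpha> unfolding eq by (simp add: Beta_commute)
  qed (use \<alpha> ab p assms in auto)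
qed

lemma necessary_a:
  assumes "a + 1 - p * (\<alpha> + 1) \<ge> 0" "a + 1 - p * (\<alpha> + 1) > 0 \<or> p > 1"
  shows False
proof (rule Beta_le_of_bounded)
  fix K assume K: "\<And>u v. \<alpha> + u > 0 \<Longrightarrow> \<beta> + v > 0 \<Longrightarrow> a + 1 + p * (u - 1) > 0 \<Longrightarrow> b + 1 + p * (v - 1) > 0 \<Longrightarrow>
    Beta (\<alpha> + u) (\<beta> + v) \<le> K * Beta (a + 1 + p * (u - 1)) (b + 1 + p * (v - 1)) powr (1 / p)"
  show False
  proof (rule no_Beta_blowup_bound[of "\<beta> + 1" "b + 1" p "a + 1 - p * (\<alpha> + 1)" K])
    fix e :: real assume e: "e > 0"
    have eq: "a + 1 + p * (e - \<alpha> - 1) = a + 1 - p * (\<alpha> + 1) + p * e" by (simp add: algebra_simps)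
    have "a + 1 - p * (\<alpha> + 1) + p * e > 0"
      using e p assms(1) by (intro add_nonneg_pos mult_pos_pos) auto
    then show "Beta e (\<beta> + 1) \<le> K * Beta (a + 1 - p * (\<alpha> + 1) + p * e) (b + 1) powr (1 / p)"
      \<comment> \<open>The mirror choice: now \<alpha>+u = e approaches the pole and the parameters
        at the origin are fixed.\<close>
      using K[of "e - \<alpha>" 1] e ab \<beta> unfolding eq by simp
  qed (use \<beta> ab p assms in auto)
qed

text \<open>Norm and constant term of the image both grow like 1/e here. Integrating the full series
  over \<open>mu a b\<close> weights the n-th term by coef_n^2 B(2\<alpha>+3, b+1+n), which is of
  order 1/n, so boundedness would bound the harmonic sums.\<close>

lemma necessary_endpoint:
  assumes p1: "p = 1" and a: "a = \<alpha>"
  shows False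
proof -
  have B: "Beta (\<alpha> + 1) (\<beta> + 1) > 0" "Beta (\<alpha> + 1) (b + 1) > 0"
    using \<alpha> \<beta> ab by (auto intro: Beta_pos_real)
  obtain C where C: "C \<ge> 0" "\<And>f. f \<in> Lp_space (mu a b) p \<Longrightarrow>
    (\<integral>\<^sup>+z. ennreal (norm (berezin \<alpha> \<beta> f z) powr p) \<partial>mu a b) \<le> ennreal (C * (\<integral>w. norm (f w) powr p \<partial>mu a b))"
    by (rule integral_berezin_le) blast
  obtain D where D: "D > 0" "\<And>x. 0 \<le> x \<Longrightarrow> x < 1 \<Longrightarrow> diag x \<le> D * (1 - x) powr (- (\<alpha> + 2))"
    by (rule diag_bounds) blast
  \<comment> \<open>The parameter 2\<alpha>+3 is \<alpha> from the measure plus \<alpha>+2 from the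
    lower bound for 1 / \<open>diag\<close>, shifted by one. The growth exponent 2(\<alpha>+1) -
    (2\<alpha>+3) = -1 is the harmonic one.\<close>
  let ?g = "\<lambda>n. coef n * coef n * Beta (2 * \<alpha> + 3) (b + 1 + real n)"
  have "power_growth ?g (\<alpha> + 1 + (\<alpha> + 1) + (- (2 * \<alpha> + 3)))"
    using \<alpha> ab by (intro power_growth_mult power_growth_coef power_growth_Beta) auto
  then have "power_growth ?g (- 1)" by simp
  then obtain c where c: "c > 0" "\<And>n. c * (real n + 1) powr (- 1) \<le> ?g n"
    by (rule power_growth_lower) blast
  define k where "k = 1 / D / Beta (\<alpha> + 1) (\<beta> + 1)"
  have k: "k > 0" using D(1) B by (simp add: k_def)
  let ?K = "C / (k * c)"
  have key: "(\<Sum>n<N. Beta e (\<beta> + 1 + real n) / (real n + 1)) \<le> ?K * Beta e (b + 1)" if e: "e > 0" for e N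
  proof -
    let ?f = "test_fun (e - \<alpha>) 1"
    have pos: "a + 1 + p * ((e - \<alpha>) - 1) > 0" "b + 1 + p * (1 - 1) > 0" "\<alpha> + (e - \<alpha>) > 0" "\<beta> + 1 > 0"
      using e p1 a ab \<beta> by auto
    note f = test_fun_in_Lp[OF pos(1,2)]
    define t where "t n = (coef n)\<^sup>2 * Beta e (\<beta> + 1 + real n)" for n
    have t: "t n \<ge> 0" for n using e \<beta> Beta_pos_real[of e "\<beta> + 1 + real n"] by (simp add: t_def)
    have low: "ennreal k * (\<Sum>n. ennreal (t n) * ennreal (beta_weight (\<alpha> + 3) (real n + 1) ((norm z)\<^sup>2))) \<le>
        ennreal (norm (berezin \<alpha> \<beta> ?f z) powr p)" if z0: "z \<noteq> 0" and z: "norm z < 1" for z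
    proof -
      have x: "0 \<le> (norm z)\<^sup>2" "(norm z)\<^sup>2 < 1" using z by (auto simp: abs_square_less_1)
      have dpos: "diag ((norm z)\<^sup>2) > 0" by (rule diag_pos[OF z])
      have "(1 - (norm z)\<^sup>2) powr (\<alpha> + 2) / D = 1 / (D * (1 - (norm z)\<^sup>2) powr (- (\<alpha> + 2)))"
        unfolding powr_minus_divide by simp
      also have "\<dots> \<le> 1 / diag ((norm z)\<^sup>2)"
        using D(2)[OF x] dpos by (intro divide_left_mono) (auto intro!: mult_pos_pos D(1) simp: x)
      finally have 1: "k * (1 - (norm z)\<^sup>2) powr (\<alpha> + 2) \<le> 1 / diag ((norm z)\<^sup>2) / Beta (\<alpha> + 1) (\<beta> + 1)"
        using divide_right_mono[of _ _ "Beta (\<alpha> + 1) (\<beta> + 1)"] B unfolding k_def by fastforce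
      \<comment> \<open>For n = 0 this identity fails at the origin, where
        \<open>0 powr 0 = 0\<close>; hence the estimate is for z different from 0 and is integrated
        almost everywhere.\<close>
      have bw: "beta_weight (\<alpha> + 3) (real n + 1) ((norm z)\<^sup>2) = (1 - (norm z)\<^sup>2) powr (\<alpha> + 2) * ((norm z)\<^sup>2) ^ n" for n
      proof -
        have "\<alpha> + 3 - 1 = \<alpha> + 2" by simp
        then show ?thesis using z0 by (simp only: beta_weight_def) (simp add: powr_realpow mult.commute)
      qed
      have "ennreal k * (\<Sum>n. ennreal (t n) * ennreal (beta_weight (\<alpha> + 3) (real n + 1) ((norm z)\<^sup>2))) =
          ennreal k * (\<Sum>n. ennreal ((1 - (norm z)\<^sup>2) powr (\<alpha> + 2)) * ennreal (t n * ((norm z)\<^sup>2) ^ n))"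
      proof -
        have "ennreal (t n) * ennreal (beta_weight (\<alpha> + 3) (real n + 1) ((norm z)\<^sup>2)) =
            ennreal ((1 - (norm z)\<^sup>2) powr (\<alpha> + 2)) * ennreal (t n * ((norm z)\<^sup>2) ^ n)" for n
          unfolding bw ennreal_mult[OF t zero_le_power[OF zero_le_power2]]
          by (simp add: ennreal_mult mult_ac)
        then show ?thesis by simp
      qed
      also have "\<dots> = ennreal (k * (1 - (norm z)\<^sup>2) powr (\<alpha> + 2)) * (\<Sum>n. ennreal (t n * ((norm z)\<^sup>2) ^ n))"
        using k by (simp add: ennreal_suminf_cmult ennreal_mult mult.assoc)
      also have "\<dots> \<le> ennreal (1 / diag ((norm z)\<^sup>2) / Beta (\<alpha> + 1) (\<beta> + 1)) * (\<Sum>n. ennreal (t n * ((norm z)\<^sup>2) ^ n))"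
        by (intro mult_right_mono ennreal_leI 1) auto
      also have "\<dots> = ennreal (norm (berezin \<alpha> \<beta> ?f z))"
        using norm_berezin_test_fun[OF f z pos(3,4)] by (simp add: t_def)
      also have "\<dots> = ennreal (norm (berezin \<alpha> \<beta> ?f z) powr p)" by (simp add: p1)
      finally show ?thesis .
    qed
    have int: "(\<integral>\<^sup>+z. ennreal (beta_weight (\<alpha> + 3) (real n + 1) ((norm z)\<^sup>2)) \<partial>mu a b) =
        ennreal (Beta (2 * \<alpha> + 3) (b + 1 + real n) / Beta (\<alpha> + 1) (b + 1))" for n
      using nn_integral_mu_beta_weight[OF ab, of "\<alpha> + 3" "real n + 1"] a \<alpha> ab by (simp add: algebra_simps)
    have sum_le: "(\<Sum>n<N. c * Beta e (\<beta> + 1 + real n) / (real n + 1)) \<le> (\<Sum>n<N. t n * Beta (2 * \<alpha> + 3) (b + 1 + real n))"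
    proof (rule sum_mono)
      fix n
      have "c / (real n + 1) * Beta e (\<beta> + 1 + real n) \<le> ?g n * Beta e (\<beta> + 1 + real n)"
        using c(2)[of n] e \<beta> Beta_pos_real[of e "\<beta> + 1 + real n"]
        by (intro mult_right_mono) (auto simp: powr_minus divide_inverse)
      then show "c * Beta e (\<beta> + 1 + real n) / (real n + 1) \<le> t n * Beta (2 * \<alpha> + 3) (b + 1 + real n)"
        by (simp add: t_def power2_eq_square mult_ac)
    qed
    have bm [measurable]: "(\<lambda>z. ennreal (beta_weight (\<alpha> + 3) (real n + 1) ((norm z)\<^sup>2))) \<in> borel_measurable (mu a b)" for n
      by (rule borel_measurable_muI) measurable
    have Bnn: "Beta (2 * \<alpha> + 3) (b + 1 + real n) \<ge> 0" for n
      using Beta_pos_real[of "2 * \<alpha> + 3" "b + 1 + real n"] \<alpha> ab by simp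
    have "ennreal (k * ((\<Sum>n<N. t n * Beta (2 * \<alpha> + 3) (b + 1 + real n)) / Beta (\<alpha> + 1) (b + 1))) =
        ennreal k * (\<Sum>n<N. ennreal (t n) * (\<integral>\<^sup>+z. ennreal (beta_weight (\<alpha> + 3) (real n + 1) ((norm z)\<^sup>2)) \<partial>mu a b))"
    proof -
      have "ennreal (t n) * ennreal (Beta (2 * \<alpha> + 3) (b + 1 + real n) / Beta (\<alpha> + 1) (b + 1)) =
          ennreal (t n * Beta (2 * \<alpha> + 3) (b + 1 + real n) / Beta (\<alpha> + 1) (b + 1))" for n
        using t Bnn B by (subst ennreal_mult[symmetric]) auto
      moreover have "t n * Beta (2 * \<alpha> + 3) (b + 1 + real n) / Beta (\<alpha> + 1) (b + 1) \<ge> 0" for n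
        using t[of n] Bnn[of n] B by simp
      ultimately show ?thesis
        unfolding int sum_divide_distrib using k by (simp only: sum_ennreal) (simp add: ennreal_mult sum_nonneg)
    qed
    also have "\<dots> \<le> ennreal k * (\<Sum>n. ennreal (t n) * (\<integral>\<^sup>+z. ennreal (beta_weight (\<alpha> + 3) (real n + 1) ((norm z)\<^sup>2)) \<partial>mu a b))"
      by (intro mult_left_mono sum_le_suminf summableI) auto
    also have "\<dots> = ennreal k * (\<Sum>n. (\<integral>\<^sup>+z. ennreal (t n) * ennreal (beta_weight (\<alpha> + 3) (real n + 1) ((norm z)\<^sup>2)) \<partial>mu a b))"
      by (simp only: nn_integral_cmult[OF bm])
    also have "\<dots> = ennreal k * (\<integral>\<^sup>+z. (\<Sum>n. ennreal (t n) * ennreal (beta_weight (\<alpha> + 3) (real n + 1) ((norm z)\<^sup>2))) \<partial>mu a b)"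
      by (subst nn_integral_suminf) measurable
    also have "\<dots> = (\<integral>\<^sup>+z. ennreal k * (\<Sum>n. ennreal (t n) * ennreal (beta_weight (\<alpha> + 3) (real n + 1) ((norm z)\<^sup>2))) \<partial>mu a b)"
      by (rule nn_integral_cmult[symmetric]) measurable
    also have "\<dots> \<le> (\<integral>\<^sup>+z. ennreal (norm (berezin \<alpha> \<beta> ?f z) powr p) \<partial>mu a b)"
      by (intro nn_integral_mono_AE eventually_mono[OF AE_mu_nonzero[OF ab]]) (use low in blast)
    also have "\<dots> \<le> ennreal (C * (Beta e (b + 1) / Beta (\<alpha> + 1) (b + 1)))"
      using C(2)[OF f] unfolding integral_test_fun[OF pos(1,2)] by (simp add: p1 a)
    finally have "k * ((\<Sum>n<N. t n * Beta (2 * \<alpha> + 3) (b + 1 + real n)) / Beta (\<alpha> + 1) (b + 1)) \<le>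
        C * (Beta e (b + 1) / Beta (\<alpha> + 1) (b + 1))"
      using C(1) B Beta_pos_real[of e "b + 1"] e ab by (subst (asm) ennreal_le_iff) auto
    then have "k * (\<Sum>n<N. t n * Beta (2 * \<alpha> + 3) (b + 1 + real n)) \<le> C * Beta e (b + 1)"
      using B by (simp add: divide_le_cancel)
    moreover have "k * (\<Sum>n<N. c * Beta e (\<beta> + 1 + real n) / (real n + 1)) \<le>
        k * (\<Sum>n<N. t n * Beta (2 * \<alpha> + 3) (b + 1 + real n))"
      using sum_le k by (intro mult_left_mono) auto
    ultimately have "k * (\<Sum>n<N. c * Beta e (\<beta> + 1 + real n) / (real n + 1)) \<le> C * Beta e (b + 1)"
      by (rule order_trans[rotated])
    also have "k * (\<Sum>n<N. c * Beta e (\<beta> + 1 + real n) / (real n + 1)) =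
        (k * c) * (\<Sum>n<N. Beta e (\<beta> + 1 + real n) / (real n + 1))"
      by (simp add: sum_distrib_left mult.assoc)
    finally show ?thesis using k c(1) by (simp add: field_simps)
  qed
  \<comment> \<open>With N fixed, e -> 0 is a limit of finitely many terms. Since e * Beta e y -> 1
    for every y, the shifts in the arguments disappear and the partial harmonic sum is bounded by a
    constant independent of N.\<close>
  have "(\<Sum>n<N. 1 / (real n + 1)) \<le> ?K * 1" for N
  proof (rule tendsto_le)
    show "((\<lambda>e. \<Sum>n<N. (e * Beta e (\<beta> + 1 + real n)) / (real n + 1)) \<longlongrightarrow> (\<Sum>n<N. 1 / (real n + 1))) (at_right 0)"
      using \<beta> by (intro tendsto_sum tendsto_divide tendsto_const tendsto_mult_Beta_at_right_0) auto
    show "((\<lambda>e. ?K * (e * Beta e (b + 1))) \<longlongrightarrow> ?K * 1) (at_right 0)"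
      using ab by (intro tendsto_mult tendsto_const tendsto_mult_Beta_at_right_0) auto
    show "\<forall>\<^sub>F e in at_right 0. (\<Sum>n<N. (e * Beta e (\<beta> + 1 + real n)) / (real n + 1)) \<le> ?K * (e * Beta e (b + 1))"
      unfolding eventually_at_filter
    proof (intro always_eventually allI impI)
      fix e :: real assume "e \<in> {0<..}"
      then have e: "e > 0" by simp
      have "e * (\<Sum>n<N. Beta e (\<beta> + 1 + real n) / (real n + 1)) \<le> e * (?K * Beta e (b + 1))"
        using key[OF e] e by (intro mult_left_mono) auto
      then show "(\<Sum>n<N. (e * Beta e (\<beta> + 1 + real n)) / (real n + 1)) \<le> ?K * (e * Beta e (b + 1))"
        by (simp only: sum_distrib_left mult.left_commute times_divide_eq_right)
    qed
  qed simp
  then have "summable (\<lambda>n. 1 / (real n + 1))"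
    by (intro summableI_nonneg_bounded[where x = "?K * 1"]) auto
  then have "summable (\<lambda>n. inverse (real (Suc n)))"
    by (simp add: divide_inverse add.commute)
  then have "summable (\<lambda>n. inverse (real n))" by (subst (asm) summable_Suc_iff)
  then show False using not_summable_harmonic[where 'a = real] by simp
qed

text \<open>For p > 1 equality of exponents is already excluded by the blow-up comparison. For p = 1
  that comparison excludes only a > \<alpha> and b > \<beta>; the endpoint argument removes a =
  \<alpha>, while b = \<beta> remains admissible.\<close>

lemma berezin_bounded_necessary:
  "p * (\<alpha> + 1) > a + 1 \<and> (if p = 1 then b \<le> \<beta> else b < p * (\<beta> + 1) - 1)"
proof -
  have "p * (\<alpha> + 1) > a + 1"
    using necessary_a necessary_endpoint p by (cases "p = 1") force+
  moreover have "if p = 1 then b \<le> \<beta> else b < p * (\<beta> + 1) - 1"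
    using necessary_b p by (cases "p = 1") force+
  ultimately show ?thesis ..
qed

end

end

theorem theorem1:
  fixes \<alpha> \<beta> a b p :: real
  assumes "- 1 < \<alpha>" and "- 1 < a" and "- 1 < b"
    and "- 1 < \<beta>" and "\<beta> \<le> 0" and "1 \<le> p"
  shows "berezin_bounded \<alpha> \<beta> a b p \<longleftrightarrow>
           p * (\<alpha> + 1) > a + 1 \<and>
           (if p = 1 then b \<le> \<beta> else b < p * (\<beta> + 1) - 1)"
proof -
  interpret kernel_parameters \<alpha> \<beta> by unfold_locales fact+
  show ?thesis
    using berezin_bounded_sufficient[of a b p] berezin_bounded_necessary[of a b p] assms by blast
qed

end
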